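(* Let $\Sigma=(A,G,\alpha,\sigma)$ be a twisted unital discrete C$^*$-dynamical system with $G$ in the class $\mathcal{P}$. If $A$ has a unique invariant tracial state, then $C_r^*(\Sigma)$ has a unique tracial state. If $\Sigma$ is minimal, then $C_r^*(\Sigma)$ is simple.
   Context: Conventions: an ideal of a C$^*$-algebra always means a closed two-sided ideal. A twisted unital discrete C$^*$-dynamical system $\Sigma=(A,G,\alpha,\sigma)$ consists of a unital C$^*$-algebra $A$, a discrete group $G$ with identity $e$, and maps $\alpha:G\to\mathrm{Aut}(A)$, $\sigma:G\times G\to\mathcal{U}(A)$ (the unitary group of $A$) such that for all $g,h,k\in G$: $\alpha_g\circ\alpha_h=\mathrm{Ad}(\sigma(g,h))\circ\alpha_{gh}$, $\sigma(g,h)\sigma(gh,k)=\alpha_g(\sigma(h,k))\sigma(g,hk)$, $\sigma(g,e)=\sigma(e,g)=1$. The reduced crossed product $C_r^*(\Sigma)$ is characterized up to isomorphism as follows: it is a C$^*$-algebra generated by (a copy of) $A$ and unitaries $\{\lambda(g)\mid g\in G\}$ with $\alpha_g(a)=\lambda(g)a\lambda(g)^*$ and $\lambda(g)\lambda(h)=\sigma(g,h)\lambda(gh)$ for all $g,h\in G$, $a\in A$, and there is a faithful conditional expectation $E:C_r^*(\Sigma)\to A$ with $E(\lambda(g))=0$ for all $g\ne e$. A tracial state $\varphi$ of $A$ is invariant if $\varphi\circ\alpha_g=\varphi$ for all $g\in G$. An ideal $J$ of $A$ is invariant if $\alpha_g(J)=J$ for all $g\in G$. $\Sigma$ is minimal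 if $\{0\}$ is the only proper invariant ideal of $A$. The class $\mathcal{P}$ consists of all discrete groups that are PH groups or have property $(P_{\rm com})$, defined as follows ($\mathbb{N}=\{1,2,\dots\}$). PH groups: For $g\in G$ and $S\subset G$ put $\langle g\rangle_S=\{sgs^{-1}\mid s\in S\}$. If $T\subset G$ and $\emptyset\ne M\subset G\setminus\{e\}$, $T$ is $M$-large if $m(G\setminus T)\subset T$ for all $m\in M$. If $\emptyset\ne F\subset G\setminus\{e\}$ and $H\subset G$, $H$ is a Powers set for $F$ if for any $N\in\mathbb{N}$ there exist $h_1,\dots,h_N\in H$ and pairwise disjoint subsets $T_1,\dots,T_N$ of $G$ such that $T_j$ is $h_jFh_j^{-1}$-large for $j=1,\dots,N$. If $g\in G\setminus\{e\}$, $H$ is a c-Powers set for $g$ if $H$ is a Powers set for $\langle g\rangle_M$ for all finite non-empty subsets $M$ of $H$. $G$ is a PH group if, given any finite non-empty subset $F$ of $G\setminus\{e\}$, one can write $F=\{f_1,\dots,f_n\}$ and find a chain of subgroups $G_1\subset G_2\subset\cdots\subset G_n\subset G$ such that $G_j$ is a c-Powers set for $f_j$, $j=1,\dots,n$. Property $(P_{\rm com})$: for any non-empty finite subset $F\subset G\setminus\{e\}$ there exist $n\in\mathbb{N}$, $g_0\in G$ and subsets $U,D_1,\dots,D_n$ of $G$ such that (i) $G\setminus U\subset D_1\cup\cdots\cup D_n$; (ii) $gU\cap U=\emptyset$ for all $g\in F$; (iii) $g_0^{-j}D_k\cap D_k=\emptyset$ for all $j\in\mathbb{N}$ and $k=1,\dots,n$.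 *)

theory Defs
  imports
    Complex_Main
    "HOL-Algebra.Coset"
    "HOL-Library.Disjoint_Sets"
    "HOL-Library.Nonpos_Ints"
begin

section \<open>Unital C*-algebras\<close>

text \<open>
  The algebras are whole types. The class \<open>real_normed_algebra_1\<close> forces \<open>1 \<noteq> 0\<close>, so the zero
  algebra is excluded. The complex scalar action is required to extend the real one.
\<close>

class unital_cstar_algebra = real_normed_algebra_1 + banach +
  fixes scaleC :: "complex \<Rightarrow> 'a \<Rightarrow> 'a" (infixr "*\<^sub>C" 75)
    and adj :: "'a \<Rightarrow> 'a" ("_\<^sup>\<star>" [1000] 1000)
  assumes scaleC_add_right: "c *\<^sub>C (x + y) = c *\<^sub>C x + c *\<^sub>C y"
    and scaleC_add_left: "(c + d) *\<^sub>C x = c *\<^sub>C x + d *\<^sub>C x"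
    and scaleC_scaleC: "c *\<^sub>C (d *\<^sub>C x) = (c * d) *\<^sub>C x"
    and scaleR_scaleC: "r *\<^sub>R x = complex_of_real r *\<^sub>C x"
    and mult_scaleC_left: "(c *\<^sub>C x) * y = c *\<^sub>C (x * y)"
    and mult_scaleC_right: "x * (c *\<^sub>C y) = c *\<^sub>C (x * y)"
    and norm_scaleC: "norm (c *\<^sub>C x) = cmod c * norm x"
    and adj_adj: "x\<^sup>\<star>\<^sup>\<star> = x"
    and adj_add: "(x + y)\<^sup>\<star> = x\<^sup>\<star> + y\<^sup>\<star>"
    and adj_scaleC: "(c *\<^sub>C x)\<^sup>\<star> = cnj c *\<^sub>C x\<^sup>\<star>"
    and adj_mult: "(x * y)\<^sup>\<star> = y\<^sup>\<star> * x\<^sup>\<star>"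
    and cstar_identity: "norm (x\<^sup>\<star> * x) = (norm x)\<^sup>2"

instantiation complex :: unital_cstar_algebra
begin

definition scaleC_complex :: "complex \<Rightarrow> complex \<Rightarrow> complex"
  where "scaleC_complex c x = c * x"

definition adj_complex :: "complex \<Rightarrow> complex"
  where "adj_complex x = cnj x"

instance
  by standard
    (simp_all add: scaleC_complex_def adj_complex_def algebra_simps scaleR_conv_of_real
      norm_mult power2_eq_square)

end

definition clinear :: "('a::unital_cstar_algebra \<Rightarrow> 'b::unital_cstar_algebra) \<Rightarrow> bool" where
  "clinear f \<longleftrightarrow> (\<forall>x y. f (x + y) = f x + f y) \<and> (\<forall>c x. f (c *\<^sub>C x) = c *\<^sub>C f x)"

definition unital_star_hom :: "('a::unital_cstar_algebra \<Rightarrow> 'b::unital_cstar_algebra) \<Rightarrow> bool" where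
  "unital_star_hom f \<longleftrightarrow>
     clinear f \<and> (\<forall>x y. f (x * y) = f x * f y) \<and> (\<forall>x. f (x\<^sup>\<star>) = (f x)\<^sup>\<star>) \<and> f 1 = 1"

definition star_automorphism :: "('a::unital_cstar_algebra \<Rightarrow> 'a) \<Rightarrow> bool" where
  "star_automorphism f \<longleftrightarrow> unital_star_hom f \<and> bij f"

definition unitary :: "'a::unital_cstar_algebra \<Rightarrow> bool" where
  "unitary u \<longleftrightarrow> u\<^sup>\<star> * u = 1 \<and> u * u\<^sup>\<star> = 1"

definition Ad :: "'a::unital_cstar_algebra \<Rightarrow> 'a \<Rightarrow> 'a" where
  "Ad u a = u * a * u\<^sup>\<star>"

definition positive :: "'a::unital_cstar_algebra \<Rightarrow> bool" where
  "positive a \<longleftrightarrow> (\<exists>b. a = b\<^sup>\<star> * b)"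

definition state :: "('a::unital_cstar_algebra \<Rightarrow> complex) \<Rightarrow> bool" where
  "state \<phi> \<longleftrightarrow> clinear \<phi> \<and> (\<forall>a. positive a \<longrightarrow> \<phi> a \<in> \<real>\<^sub>\<ge>\<^sub>0) \<and> \<phi> 1 = 1"

definition tracial_state :: "('a::unital_cstar_algebra \<Rightarrow> complex) \<Rightarrow> bool" where
  "tracial_state \<phi> \<longleftrightarrow> state \<phi> \<and> (\<forall>x y. \<phi> (x * y) = \<phi> (y * x))"

definition cstar_ideal :: "'a::unital_cstar_algebra set \<Rightarrow> bool" where
  "cstar_ideal J \<longleftrightarrow>
     0 \<in> J \<and> (\<forall>x\<in>J. \<forall>y\<in>J. x + y \<in> J) \<and> (\<forall>c. \<forall>x\<in>J. c *\<^sub>C x \<in> J) \<and>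
     (\<forall>a. \<forall>x\<in>J. a * x \<in> J \<and> x * a \<in> J) \<and> closed J"

definition cstar_simple :: "'a::unital_cstar_algebra itself \<Rightarrow> bool" where
  "cstar_simple _ \<longleftrightarrow> (\<forall>J::'a set. cstar_ideal J \<and> J \<noteq> UNIV \<longleftrightarrow> J = {0})"

definition cstar_subalgebra :: "'a::unital_cstar_algebra set \<Rightarrow> bool" where
  "cstar_subalgebra S \<longleftrightarrow>
     0 \<in> S \<and> (\<forall>x\<in>S. \<forall>y\<in>S. x + y \<in> S) \<and> (\<forall>c. \<forall>x\<in>S. c *\<^sub>C x \<in> S) \<and>
     (\<forall>x\<in>S. \<forall>y\<in>S. x * y \<in> S) \<and> (\<forall>x\<in>S. x\<^sup>\<star> \<in> S) \<and> closed S"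

definition cstar_generated :: "'a::unital_cstar_algebra set \<Rightarrow> 'a set" where
  "cstar_generated X = \<Inter>{S. cstar_subalgebra S \<and> X \<subseteq> S}"

text \<open>
  Here \<open>\<iota>\<close> embeds \<open>A\<close> into the ambient algebra, and \<open>\<iota> \<circ> E\<close> is the usual idempotent map onto
  \<open>\<iota>(A)\<close>. Contractivity and complete positivity are consequences of the listed conditions.
\<close>

definition conditional_expectation ::
    "('a::unital_cstar_algebra \<Rightarrow> 'b::unital_cstar_algebra) \<Rightarrow> ('b \<Rightarrow> 'a) \<Rightarrow> bool" where
  "conditional_expectation \<iota> E \<longleftrightarrow>
     clinear E \<and> (\<forall>x. positive x \<longrightarrow> positive (E x)) \<and> (\<forall>a. E (\<iota> a) = a) \<and>
     (\<forall>a b x. E (\<iota> a * x * \<iota> b) = a * E x * b)"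

definition faithful :: "('b::unital_cstar_algebra \<Rightarrow> 'a::unital_cstar_algebra) \<Rightarrow> bool" where
  "faithful E \<longleftrightarrow> (\<forall>x. positive x \<and> E x = 0 \<longrightarrow> x = 0)"

section \<open>Twisted C*-dynamical systems and their reduced crossed products\<close>

locale twisted_cstar_system = group G for G (structure) +
  fixes \<alpha> :: "'g \<Rightarrow> 'a::unital_cstar_algebra \<Rightarrow> 'a"
    and \<sigma> :: "'g \<Rightarrow> 'g \<Rightarrow> 'a"
  assumes automorphism: "g \<in> carrier G \<Longrightarrow> star_automorphism (\<alpha> g)"
    and unitary_cocycle: "g \<in> carrier G \<Longrightarrow> h \<in> carrier G \<Longrightarrow> unitary (\<sigma> g h)"
    and twisted_action: "g \<in> carrier G \<Longrightarrow> h \<in> carrier G \<Longrightarrow>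
          \<alpha> g \<circ> \<alpha> h = Ad (\<sigma> g h) \<circ> \<alpha> (g \<otimes> h)"
    and cocycle: "g \<in> carrier G \<Longrightarrow> h \<in> carrier G \<Longrightarrow> k \<in> carrier G \<Longrightarrow>
          \<sigma> g h * \<sigma> (g \<otimes> h) k = \<alpha> g (\<sigma> h k) * \<sigma> g (h \<otimes> k)"
    and normalized: "g \<in> carrier G \<Longrightarrow> \<sigma> g \<one> = 1" "g \<in> carrier G \<Longrightarrow> \<sigma> \<one> g = 1"

definition invariant_tracial_state ::
    "('g, 'm) monoid_scheme \<Rightarrow> ('g \<Rightarrow> 'a::unital_cstar_algebra \<Rightarrow> 'a) \<Rightarrow> ('a \<Rightarrow> complex) \<Rightarrow> bool" where
  "invariant_tracial_state G \<alpha> \<phi> \<longleftrightarrow> tracial_state \<phi> \<and> (\<forall>g\<in>carrier G. \<phi> \<circ> \<alpha> g = \<phi>)"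

definition invariant_ideal ::
    "('g, 'm) monoid_scheme \<Rightarrow> ('g \<Rightarrow> 'a::unital_cstar_algebra \<Rightarrow> 'a) \<Rightarrow> 'a set \<Rightarrow> bool" where
  "invariant_ideal G \<alpha> J \<longleftrightarrow> cstar_ideal J \<and> (\<forall>g\<in>carrier G. \<alpha> g ` J = J)"

definition minimal_system ::
    "('g, 'm) monoid_scheme \<Rightarrow> ('g \<Rightarrow> 'a::unital_cstar_algebra \<Rightarrow> 'a) \<Rightarrow> bool" where
  "minimal_system G \<alpha> \<longleftrightarrow> (\<forall>J. invariant_ideal G \<alpha> J \<and> J \<noteq> UNIV \<longleftrightarrow> J = {0})"

text \<open>
  The type \<open>'b\<close>, with the embedding \<open>\<iota>\<close> of \<open>A\<close> and the unitaries \<open>\<lambda>(g) = l g\<close>, is a model of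
  the reduced crossed product. The conditions determine it up to isomorphism.
\<close>

definition is_reduced_crossed_product ::
    "('g, 'm) monoid_scheme \<Rightarrow> ('g \<Rightarrow> 'a::unital_cstar_algebra \<Rightarrow> 'a) \<Rightarrow> ('g \<Rightarrow> 'g \<Rightarrow> 'a) \<Rightarrow>
     ('a \<Rightarrow> 'b::unital_cstar_algebra) \<Rightarrow> ('g \<Rightarrow> 'b) \<Rightarrow> bool" where
  "is_reduced_crossed_product G \<alpha> \<sigma> \<iota> l \<longleftrightarrow>
     unital_star_hom \<iota> \<and> inj \<iota> \<and>
     (\<forall>g\<in>carrier G. unitary (l g)) \<and>
     cstar_generated (range \<iota> \<union> l ` carrier G) = UNIV \<and>
     (\<forall>g\<in>carrier G. \<forall>a. \<iota> (\<alpha> g a) = l g * \<iota> a * (l g)\<^sup>\<star>) \<and>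
     (\<forall>g\<in>carrier G. \<forall>h\<in>carrier G. l g * l h = \<iota> (\<sigma> g h) * l (g \<otimes>\<^bsub>G\<^esub> h)) \<and>
     (\<exists>E. conditional_expectation \<iota> E \<and> faithful E \<and>
          (\<forall>g\<in>carrier G. g \<noteq> \<one>\<^bsub>G\<^esub> \<longrightarrow> E (l g) = 0))"

section \<open>The class P of groups\<close>

definition conj_orbit :: "('g, 'm) monoid_scheme \<Rightarrow> 'g set \<Rightarrow> 'g \<Rightarrow> 'g set" where
  "conj_orbit G S g = {s \<otimes>\<^bsub>G\<^esub> g \<otimes>\<^bsub>G\<^esub> inv\<^bsub>G\<^esub> s | s. s \<in> S}"

definition conj_set :: "('g, 'm) monoid_scheme \<Rightarrow> 'g \<Rightarrow> 'g set \<Rightarrow> 'g set" where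
  "conj_set G h F = (\<lambda>f. h \<otimes>\<^bsub>G\<^esub> f \<otimes>\<^bsub>G\<^esub> inv\<^bsub>G\<^esub> h) ` F"

definition large_for :: "('g, 'm) monoid_scheme \<Rightarrow> 'g set \<Rightarrow> 'g set \<Rightarrow> bool" where
  "large_for G M T \<longleftrightarrow> (\<forall>m\<in>M. m <#\<^bsub>G\<^esub> (carrier G - T) \<subseteq> T)"

definition powers_set :: "('g, 'm) monoid_scheme \<Rightarrow> 'g set \<Rightarrow> 'g set \<Rightarrow> bool" where
  "powers_set G F H \<longleftrightarrow>
     (\<forall>N::nat. N \<ge> 1 \<longrightarrow>
        (\<exists>(h :: nat \<Rightarrow> 'g) (T :: nat \<Rightarrow> 'g set).
           (\<forall>j\<in>{1..N}. h j \<in> H \<and> T j \<subseteq> carrier G) \<and>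
           disjoint_family_on T {1..N} \<and>
           (\<forall>j\<in>{1..N}. large_for G (conj_set G (h j) F) (T j))))"

definition c_powers_set :: "('g, 'm) monoid_scheme \<Rightarrow> 'g \<Rightarrow> 'g set \<Rightarrow> bool" where
  "c_powers_set G g H \<longleftrightarrow>
     (\<forall>M. finite M \<and> M \<noteq> {} \<and> M \<subseteq> H \<longrightarrow> powers_set G (conj_orbit G M g) H)"

definition PH_group :: "('g, 'm) monoid_scheme \<Rightarrow> bool" where
  "PH_group G \<longleftrightarrow>
     group G \<and>
     (\<forall>F. finite F \<and> F \<noteq> {} \<and> F \<subseteq> carrier G - {\<one>\<^bsub>G\<^esub>} \<longrightarrow>
        (\<exists>(n::nat) (f :: nat \<Rightarrow> 'g) (K :: nat \<Rightarrow> 'g set).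
           bij_betw f {1..n} F \<and>
           (\<forall>j\<in>{1..n}. subgroup (K j) G) \<and>
           (\<forall>i\<in>{1..n}. \<forall>j\<in>{1..n}. i \<le> j \<longrightarrow> K i \<subseteq> K j) \<and>
           (\<forall>j\<in>{1..n}. c_powers_set G (f j) (K j))))"

definition P_com_group :: "('g, 'm) monoid_scheme \<Rightarrow> bool" where
  "P_com_group G \<longleftrightarrow>
     group G \<and>
     (\<forall>F. finite F \<and> F \<noteq> {} \<and> F \<subseteq> carrier G - {\<one>\<^bsub>G\<^esub>} \<longrightarrow>
        (\<exists>(n::nat) g\<^sub>0 U (D :: nat \<Rightarrow> 'g set).
           n \<ge> 1 \<and> g\<^sub>0 \<in> carrier G \<and> U \<subseteq> carrier G \<and> (\<forall>k\<in>{1..n}. D k \<subseteq> carrier G) \<and>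
           carrier G - U \<subseteq> (\<Union>k\<in>{1..n}. D k) \<and>
           (\<forall>g\<in>F. (g <#\<^bsub>G\<^esub> U) \<inter> U = {}) \<and>
           (\<forall>j::nat. \<forall>k\<in>{1..n}. j \<ge> 1 \<longrightarrow>
              ((g\<^sub>0 [^]\<^bsub>G\<^esub> (- int j)) <#\<^bsub>G\<^esub> D k) \<inter> D k = {})))"

definition class_P :: "('g, 'm) monoid_scheme \<Rightarrow> bool" where
  "class_P G \<longleftrightarrow> PH_group G \<or> P_com_group G"

end

theory Submission
  imports Defs "HOL-Analysis.Elementary_Normed_Spaces"
begin

text \<open>
  The canonical expectation \<open>E\<close> controls everything: for each \<open>y\<close> with \<open>E y = 0\<close>, suitable averages of
  the conjugates \<open>\<lambda>(h) y \<lambda>(h)\<^sup>\<star>\<close> are arbitrarily small in norm. Traces are constant on such averages,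
  so they factor through \<open>E\<close>; and an ideal \<open>J \<noteq> 0\<close> of a minimal system contains some \<open>y\<close> with \<open>E y\<close>
  close to 1, hence an average of \<open>y\<close> close to 1.

  The averages are estimated by Powers' method in the Hilbert module with inner product
  \<open>E (x\<^sup>\<star> y)\<close>. If \<open>x\<^sub>1, \<dots>, x\<^sub>N\<close> have norm at most \<open>c\<close> and finite supports \<open>M\<^sub>j\<close>, if \<open>T\<^sub>j\<close> is
  \<open>M\<^sub>j\<close>-large and no point lies in more than \<open>n\<close> of the \<open>T\<^sub>j\<close>, then
  \<open>\<parallel>x\<^sub>1 + \<dots> + x\<^sub>N\<parallel> \<le> 2 c sqrt (n N)\<close>. In a PH group the \<open>T\<^sub>j\<close> are disjoint, and the elements
  of the support are treated one after the other along the chain of subgroups; under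
  \<open>P\<^sub>c\<^sub>o\<^sub>m\<close> take \<open>h\<^sub>j = g\<^sub>0\<^sup>j\<close> and \<open>T\<^sub>j = g\<^sub>0\<^sup>j (G - U)\<close>.
\<close>

section \<open>Positive elements of a C*-algebra\<close>

lemma scaleC_one [simp]: "1 *\<^sub>C x = (x::'a::unital_cstar_algebra)"
  using scaleR_scaleC[of 1 x, symmetric] by simp

lemma scaleC_zero_left [simp]: "0 *\<^sub>C x = (0::'a::unital_cstar_algebra)"
  using scaleR_scaleC[of 0 x] by simp

lemma scaleC_zero_right [simp]: "c *\<^sub>C 0 = (0::'a::unital_cstar_algebra)"
  using scaleC_add_right[of c 0 0] by simp

lemma scaleC_minus_left: "(- c) *\<^sub>C x = - (c *\<^sub>C x :: 'a::unital_cstar_algebra)"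
  using scaleC_add_left[of c "-c" x] by (simp add: eq_neg_iff_add_eq_0 add.commute)

lemma scaleC_minus_right: "c *\<^sub>C (- x) = - (c *\<^sub>C x :: 'a::unital_cstar_algebra)"
  using scaleC_add_right[of c x "-x"] by (simp add: eq_neg_iff_add_eq_0 add.commute)

lemma scaleC_diff_right: "c *\<^sub>C (x - y) = c *\<^sub>C x - (c *\<^sub>C y :: 'a::unital_cstar_algebra)"
  using scaleC_add_right[of c x "-y"] by (simp add: scaleC_minus_right)

lemma adj_zero [simp]: "(0::'a::unital_cstar_algebra)\<^sup>\<star> = 0"
  using adj_add[of "0::'a" 0] by simp

lemma adj_one [simp]: "(1::'a::unital_cstar_algebra)\<^sup>\<star> = 1"
  by (metis adj_adj adj_mult mult_1 mult_1_right)

lemma adj_minus: "(- x::'a::unital_cstar_algebra)\<^sup>\<star> = - x\<^sup>\<star>"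
  using adj_add[of x "-x"] by (simp add: eq_neg_iff_add_eq_0 add.commute)

lemma adj_diff: "(x - y::'a::unital_cstar_algebra)\<^sup>\<star> = x\<^sup>\<star> - y\<^sup>\<star>"
  using adj_add[of x "-y"] by (simp add: adj_minus)

lemma adj_scaleR: "(r *\<^sub>R x::'a::unital_cstar_algebra)\<^sup>\<star> = r *\<^sub>R x\<^sup>\<star>"
  by (simp add: scaleR_scaleC adj_scaleC)

lemma adj_sum: "(sum f I::'a::unital_cstar_algebra)\<^sup>\<star> = (\<Sum>i\<in>I. (f i)\<^sup>\<star>)"
  by (induction I rule: infinite_finite_induct) (simp_all add: adj_add)

lemmas adj_simps = adj_add adj_minus adj_diff adj_scaleR adj_scaleC adj_mult adj_adj

text \<open>By the C*-identity the square of \<open>norm y\<close> is at most the product of the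
  norms of its adjoint and of \<open>y\<close>; cancel \<open>norm y\<close> and apply this to
  \<open>x\<close> and to its adjoint.\<close>

lemma norm_adj [simp]: "norm ((x::'a::unital_cstar_algebra)\<^sup>\<star>) = norm x"
proof -
  have le: "norm y \<le> norm (y\<^sup>\<star>)" for y :: 'a
  proof (cases "y = 0")
    case False
    have "norm y * norm y \<le> norm (y\<^sup>\<star>) * norm y"
      using norm_mult_ineq[of "y\<^sup>\<star>" y] by (simp add: cstar_identity power2_eq_square)
    with False show ?thesis by simp
  qed simp
  show ?thesis using le[of x] le[of "x\<^sup>\<star>"] by (simp add: adj_adj)
qed

lemma bounded_linear_adj: "bounded_linear (adj :: 'a::unital_cstar_algebra \<Rightarrow> 'a)"
  by (rule bounded_linear_intro[of _ 1]) (simp_all add: adj_simps)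

lemmas tendsto_adj [tendsto_intros] = bounded_linear.tendsto[OF bounded_linear_adj]

lemma bounded_linear_scaleC: "bounded_linear ((*\<^sub>C) c :: 'a::unital_cstar_algebra \<Rightarrow> 'a)"
  by (rule bounded_linear_intro[of _ "cmod c"])
     (simp_all add: scaleC_add_right norm_scaleC scaleR_scaleC scaleC_scaleC mult.commute)

lemmas tendsto_scaleC [tendsto_intros] = bounded_linear.tendsto[OF bounded_linear_scaleC]

lemma norm_square: "(x::'a::unital_cstar_algebra)\<^sup>\<star> = x \<Longrightarrow> norm (x * x) = (norm x)\<^sup>2"
  using cstar_identity[of x] by simp

lemma norm_square_le: "norm (x\<^sup>\<star> * x) \<le> c\<^sup>2 \<Longrightarrow> 0 \<le> c \<Longrightarrow> norm (x::'a::unital_cstar_algebra) \<le> c"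
  by (rule power2_le_imp_le) (simp_all add: cstar_identity)

lemma adj_mult_eq_0: "x\<^sup>\<star> * x = 0 \<Longrightarrow> (x::'a::unital_cstar_algebra) = 0"
  using cstar_identity[of x] by simp

lemma norm_unitary: "unitary (u::'a::unital_cstar_algebra) \<Longrightarrow> norm u = 1"
  by (rule power2_eq_imp_eq) (simp_all add: unitary_def cstar_identity[symmetric])

text \<open>The limit of the iteration is \<open>1 - sqrt (1 - x)\<close>; the iterates are polynomials in \<open>x\<close> with
  nonnegative coefficients, so they are dominated by the iterates of the scalar \<open>1\<close>.\<close>

fun sqrt_iter :: "'a::real_algebra_1 \<Rightarrow> nat \<Rightarrow> 'a" where
  "sqrt_iter x 0 = 0"
| "sqrt_iter x (Suc n) = (1/2) *\<^sub>R (x + sqrt_iter x n * sqrt_iter x n)"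

text \<open>Taking another iterate for \<open>y\<close> shows that the iterates commute with each
  other, so differences of their squares factor.\<close>

lemma sqrt_iter_commute:
  assumes "x * y = y * x"
  shows "sqrt_iter x n * y = y * sqrt_iter x n"
proof (induction n)
  case (Suc n)
  let ?w = "sqrt_iter x n"
  have "?w * ?w * y = ?w * (y * ?w)" by (simp only: mult.assoc Suc)
  also have "\<dots> = y * (?w * ?w)" by (simp only: mult.assoc[symmetric] Suc)
  finally show ?case using assms by (simp add: distrib_left distrib_right)
qed simp

text \<open>The scalar majorant. It increases because \<open>t \<le> (1 + t * t) / 2\<close> is the
  nonnegativity of the square of \<open>t - 1\<close>.\<close>

lemma sqrt_iter_one: "0 \<le> sqrt_iter (1::real) n" "sqrt_iter (1::real) n \<le> 1"
    "sqrt_iter (1::real) n \<le> sqrt_iter 1 (Suc n)"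
proof -
  show nn: "0 \<le> sqrt_iter (1::real) n" for n by (cases n) simp_all
  show le1: "sqrt_iter (1::real) n \<le> 1" for n
  proof (induction n)
    case (Suc n)
    have "sqrt_iter (1::real) n * sqrt_iter 1 n \<le> 1" using Suc nn by (intro mult_le_one)
    thus ?case by simp
  qed simp
  have "0 \<le> (sqrt_iter (1::real) n - 1) * (sqrt_iter (1::real) n - 1)" by simp
  thus "sqrt_iter (1::real) n \<le> sqrt_iter 1 (Suc n)" by (simp add: algebra_simps)
qed

text \<open>The increments of the iteration are dominated by those of the bounded monotone scalar
  iteration, so the iterates converge to some \<open>w\<close> with \<open>2 w = x + w * w\<close>,
  and \<open>b\<close> is \<open>1 - w\<close>. The bound on \<open>1 - b\<close> later shows that
  \<open>b\<close> is itself a positive element.\<close>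

lemma sqrt_one_minus:
  fixes x :: "'a::unital_cstar_algebra"
  assumes sa: "x\<^sup>\<star> = x" and nx: "norm x \<le> 1"
  obtains b where "b\<^sup>\<star> = b" "b * b = 1 - x" "norm (1 - b) \<le> 1" "\<And>y. x * y = y * x \<Longrightarrow> b * y = y * b"
proof -
  let ?w = "sqrt_iter x" and ?t = "sqrt_iter (1::real)"
  have nw: "norm (?w n) \<le> ?t n" for n
  proof (induction n)
    case (Suc n)
    have "norm (x + ?w n * ?w n) \<le> 1 + ?t n * ?t n"
      by (intro norm_triangle_le add_mono nx order_trans[OF norm_mult_ineq] mult_mono Suc)
         (simp_all add: sqrt_iter_one)
    thus ?case by simp
  qed simp
  \<comment> \<open>Since consecutive iterates commute, the next increment is half the product of
    their difference and their sum, and the scalar iteration obeys the same identity.\<close>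
  have dw: "norm (?w (Suc n) - ?w n) \<le> ?t (Suc n) - ?t n" for n
  proof (induction n)
    case 0 show ?case using nx by simp
  next
    case (Suc n)
    have c: "?w (Suc n) * ?w n = ?w n * ?w (Suc n)"
      by (rule sqrt_iter_commute, rule sqrt_iter_commute[symmetric], rule refl)
    have "?w (Suc (Suc n)) - ?w (Suc n)
        = (1/2) *\<^sub>R (?w (Suc n) * ?w (Suc n) - ?w n * ?w n)"
      by (simp only: sqrt_iter.simps(2)[of x "Suc n"] sqrt_iter.simps(2)[of x n])
         (simp add: scaleR_diff_right[symmetric] scaleR_add_right[symmetric] del: sqrt_iter.simps)
    also have "\<dots> = (1/2) *\<^sub>R ((?w (Suc n) - ?w n) * (?w (Suc n) + ?w n))"
      using c by (simp add: algebra_simps del: sqrt_iter.simps)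
    finally have "norm (?w (Suc (Suc n)) - ?w (Suc n))
        = 1/2 * norm ((?w (Suc n) - ?w n) * (?w (Suc n) + ?w n))" by simp
    also have "\<dots> \<le> 1/2 * ((?t (Suc n) - ?t n) * (?t (Suc n) + ?t n))"
      by (intro mult_left_mono order_trans[OF norm_mult_ineq] mult_mono Suc norm_triangle_le
          add_mono nw) (simp_all add: sqrt_iter_one(3) del: sqrt_iter.simps)
    also have "\<dots> = ?t (Suc (Suc n)) - ?t (Suc n)"
      by (simp only: sqrt_iter.simps(2)[of "1::real" "Suc n"] sqrt_iter.simps(2)[of "1::real" n])
         (simp add: algebra_simps power2_eq_square)
    finally show ?case .
  qed
  have "convergent ?t"
  proof (rule Bseq_monoseq_convergent)
    show "Bseq ?t" by (intro BseqI'[of _ 1]) (simp add: sqrt_iter_one)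
    show "monoseq ?t" using sqrt_iter_one(3) by (intro mono_SucI1 allI)
  qed
  hence "summable (\<lambda>n. ?t (Suc n) - ?t n)"
    by (simp only: convergent_LIMSEQ_iff) (rule telescope_summable)
  hence "summable (\<lambda>n. ?w (Suc n) - ?w n)"
    by (rule summable_comparison_test') (use dw in blast)
  hence "convergent (\<lambda>n. ?w n - ?w 0)"
    by (simp only: sum_lessThan_telescope[symmetric] summable_iff_convergent)
  then obtain w where w: "?w \<longlonglongrightarrow> w" by (auto simp: convergent_def)
  have wsa: "w\<^sup>\<star> = w"
  proof -
    have "(?w n)\<^sup>\<star> = ?w n" for n by (induction n) (simp_all add: adj_simps sa)
    thus ?thesis using tendsto_adj[OF w] w LIMSEQ_unique by simp
  qed
  have "w = (1/2) *\<^sub>R (x + w * w)"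
  proof -
    have "(\<lambda>n. ?w (Suc n)) \<longlonglongrightarrow> (1/2) *\<^sub>R (x + w * w)"
      by (simp only: sqrt_iter.simps) (intro tendsto_intros w)
    thus ?thesis using w LIMSEQ_Suc LIMSEQ_unique by blast
  qed
  hence "2 *\<^sub>R w = 2 *\<^sub>R ((1/2) *\<^sub>R (x + w * w))" by simp
  hence "2 *\<^sub>R w = x + w * w" by simp
  hence wsq: "(1 - w) * (1 - w) = 1 - x" by (simp add: algebra_simps scaleR_2)
  have nw1: "norm w \<le> 1"
    using order_trans[OF nw sqrt_iter_one(2)] by (intro LIMSEQ_le_const2[OF tendsto_norm[OF w]]) blast
  have wc: "w * y = y * w" if "x * y = y * x" for y
  proof -
    have "(\<lambda>n. ?w n * y) \<longlonglongrightarrow> w * y" "(\<lambda>n. y * ?w n) \<longlonglongrightarrow> y * w"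
      by (intro tendsto_intros w)+
    thus ?thesis using sqrt_iter_commute[OF that] LIMSEQ_unique by simp
  qed
  show ?thesis
  proof (rule that[of "1 - w"])
    fix y assume "x * y = y * x"
    from wc[OF this] show "(1 - w) * y = y * (1 - w)"
      by (simp only: left_diff_distrib right_diff_distrib mult_1 mult_1_right)
  qed (use wsq nw1 in \<open>simp_all add: adj_diff wsa\<close>)
qed

text \<open>Up to \<open>positive_iff_herm_square\<close> below (Fukamiya's theorem), positivity is understood as being
  the square of a self-adjoint element, since this is what the geometry of the norm controls.\<close>

definition herm_square :: "'a::unital_cstar_algebra \<Rightarrow> bool" where
  "herm_square a \<longleftrightarrow> (\<exists>h. h\<^sup>\<star> = h \<and> a = h * h)"

lemma herm_squareI: "h\<^sup>\<star> = h \<Longrightarrow> herm_square (h * h)"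
  unfolding herm_square_def by blast

lemma herm_square_adj: "herm_square a \<Longrightarrow> a\<^sup>\<star> = a"
  unfolding herm_square_def by (auto simp: adj_mult)

lemma herm_square_scaleR:
  assumes "herm_square a" "0 \<le> r"
  shows "herm_square (r *\<^sub>R a)"
proof -
  obtain h where "h\<^sup>\<star> = h" "a = h * h" using assms unfolding herm_square_def by blast
  thus ?thesis using assms herm_squareI[of "sqrt r *\<^sub>R h"] by (simp add: adj_scaleR)
qed

text \<open>Rescaling reduces this to \<open>sqrt_one_minus\<close> for \<open>1 - a / R\<close>.
  The root satisfies the same kind of hypothesis, with \<open>sqrt R\<close> for \<open>R\<close>,
  and so has a self-adjoint root in turn.\<close>

lemma sqrt_of_norm_diff_le:
  fixes a :: "'a::unital_cstar_algebra"
  assumes sa: "a\<^sup>\<star> = a" and na: "norm (R *\<^sub>R 1 - a) \<le> R"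
  obtains b where "b\<^sup>\<star> = b" "b * b = a" "norm (sqrt R *\<^sub>R 1 - b) \<le> sqrt R"
    "\<And>y. a * y = y * a \<Longrightarrow> b * y = y * b"
proof (cases "R = 0")
  case True
  thus ?thesis using na that[of 0] by simp
next
  case False
  hence R: "R > 0" using na norm_ge_zero[of "R *\<^sub>R 1 - a"] by linarith
  define x where "x = 1 - (1/R) *\<^sub>R a"
  have "R *\<^sub>R x = R *\<^sub>R 1 - a" using R by (simp add: x_def scaleR_diff_right)
  hence "R * norm x \<le> R * 1" using na R by (metis mult_1_right abs_of_pos norm_scaleR)
  hence nx: "norm x \<le> 1" using R by simp
  have sax: "x\<^sup>\<star> = x" by (simp add: x_def adj_simps sa)
  obtain b where b: "b\<^sup>\<star> = b" "b * b = 1 - x" "norm (1 - b) \<le> 1"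
      "\<And>y. x * y = y * x \<Longrightarrow> b * y = y * b"
    using sqrt_one_minus[OF sax nx] by blast
  show ?thesis
  proof (rule that[of "sqrt R *\<^sub>R b"])
    show "(sqrt R *\<^sub>R b)\<^sup>\<star> = sqrt R *\<^sub>R b" by (simp add: adj_scaleR b)
    show "sqrt R *\<^sub>R b * sqrt R *\<^sub>R b = a" using R b(2) by (simp add: x_def)
    have "sqrt R *\<^sub>R 1 - sqrt R *\<^sub>R b = sqrt R *\<^sub>R (1 - b)" by (simp add: scaleR_diff_right)
    thus "norm (sqrt R *\<^sub>R 1 - sqrt R *\<^sub>R b) \<le> sqrt R" using b(3) R by (simp add: mult_left_le)
    fix y assume "a * y = y * a"
    hence "x * y = y * x" by (simp add: x_def left_diff_distrib right_diff_distrib)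
    from b(4)[OF this] show "sqrt R *\<^sub>R b * y = y * sqrt R *\<^sub>R b" by simp
  qed
qed

text \<open>A self-adjoint contraction is the real part of the unitary \<open>h + i sqrt (1 - h\<^sup>2)\<close>, whose square
  has real part \<open>2 h\<^sup>2 - 1\<close>.\<close>

lemma norm_one_minus_square_le:
  fixes h :: "'a::unital_cstar_algebra"
  assumes h: "h\<^sup>\<star> = h" and nh: "norm h \<le> 1"
  shows "norm (1 - h * h) \<le> 1"
proof -
  have "norm (h * h) \<le> 1" using nh by (simp add: norm_square[OF h] power_le_one)
  then obtain k where k: "k\<^sup>\<star> = k" "k * k = 1 - h * h" "\<And>y. (h * h) * y = y * (h * h) \<Longrightarrow> k * y = y * k"
    using sqrt_one_minus[of "h * h"] h by (metis adj_mult)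
  have kh: "k * h = h * k" by (rule k(3)) (simp add: mult.assoc)
  define u where "u = h + \<i> *\<^sub>C k"
  have ua: "u\<^sup>\<star> = h - \<i> *\<^sub>C k" by (simp add: u_def adj_simps h k scaleC_minus_left)
  have "u\<^sup>\<star> * u = 1" "u * u\<^sup>\<star> = 1"
    unfolding ua unfolding u_def
    by (simp_all add: distrib_left distrib_right left_diff_distrib right_diff_distrib
        mult_scaleC_left mult_scaleC_right scaleC_scaleC scaleC_minus_left scaleC_diff_right scaleC_add_right k(2) kh)
  hence nu: "norm u = 1" by (intro norm_unitary) (simp add: unitary_def)
  have sum: "u * u + u\<^sup>\<star> * u\<^sup>\<star> = 2 *\<^sub>R (h * h - k * k)"
    unfolding ua unfolding u_def
    by (simp add: distrib_left distrib_right left_diff_distrib right_diff_distrib scaleR_2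
        mult_scaleC_left mult_scaleC_right scaleC_scaleC scaleC_minus_left scaleC_diff_right scaleC_add_right k(2) kh)
  have "norm (2 *\<^sub>R (h * h - k * k)) \<le> norm u * norm u + norm (u\<^sup>\<star>) * norm (u\<^sup>\<star>)"
    unfolding sum[symmetric] by (intro norm_triangle_le add_mono norm_mult_ineq)
  hence "norm (h * h - k * k) \<le> 1" by (simp add: nu)
  moreover have "1 - h * h = (1/2) *\<^sub>R (1 - (h * h - k * k))"
  proof -
    have "1 - (h * h - k * k) = 2 *\<^sub>R (1 - h * h)" by (simp add: k(2) scaleR_2)
    thus ?thesis by simp
  qed
  ultimately show ?thesis
    using norm_triangle_ineq4[of 1 "h * h - k * k"] by simp
qed

lemma norm_diff_square_le:
  fixes h :: "'a::unital_cstar_algebra"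
  assumes h: "h\<^sup>\<star> = h"
  shows "norm (norm (h * h) *\<^sub>R 1 - h * h) \<le> norm (h * h)"
proof (cases "h = 0")
  case False
  define g where "g = (1 / norm h) *\<^sub>R h"
  have g: "g\<^sup>\<star> = g" "norm g \<le> 1" using False by (simp_all add: g_def adj_scaleR h)
  have "norm (h * h) *\<^sub>R 1 - h * h = norm (h * h) *\<^sub>R (1 - g * g)"
    using False by (simp add: g_def norm_square[OF h] scaleR_diff_right power2_eq_square)
  thus ?thesis using norm_one_minus_square_le[OF g] by (simp add: mult_left_le)
qed simp

text \<open>This replaces the spectrum by a norm inequality, from which closure under sums and
  topological closedness of the positive cone can be read off.\<close>

lemma herm_square_iff_norm:
  "herm_square a \<longleftrightarrow> a\<^sup>\<star> = a \<and> norm (norm a *\<^sub>R 1 - a) \<le> norm a"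
proof
  assume "herm_square a"
  thus "a\<^sup>\<star> = a \<and> norm (norm a *\<^sub>R 1 - a) \<le> norm a"
    using norm_diff_square_le herm_square_adj unfolding herm_square_def by metis
next
  assume "a\<^sup>\<star> = a \<and> norm (norm a *\<^sub>R 1 - a) \<le> norm a"
  thus "herm_square a" using sqrt_of_norm_diff_le herm_squareI by metis
qed

lemma herm_squareI_norm: "a\<^sup>\<star> = a \<Longrightarrow> norm (R *\<^sub>R 1 - a) \<le> R \<Longrightarrow> herm_square a"
  using sqrt_of_norm_diff_le herm_squareI by metis

lemma herm_square_sqrt:
  assumes "herm_square a"
  obtains b where "b\<^sup>\<star> = b" "b * b = a" "\<And>y. a * y = y * a \<Longrightarrow> b * y = y * b"
  using sqrt_of_norm_diff_le assms herm_square_iff_norm by metis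

lemma herm_square_add:
  fixes a b :: "'a::unital_cstar_algebra"
  assumes "herm_square a" "herm_square b"
  shows "herm_square (a + b)"
proof (rule herm_squareI_norm)
  have "(norm a + norm b) *\<^sub>R 1 - (a + b) = (norm a *\<^sub>R 1 - a) + (norm b *\<^sub>R 1 - b)"
    by (simp add: scaleR_add_left)
  thus "norm ((norm a + norm b) *\<^sub>R 1 - (a + b)) \<le> norm a + norm b"
    using assms by (simp only:) (intro norm_triangle_le add_mono, auto simp: herm_square_iff_norm)
qed (use assms in \<open>simp add: adj_add herm_square_adj\<close>)

text \<open>With \<open>a = b\<^sup>2\<close> and \<open>c - a = k\<^sup>2\<close>, \<open>b\<close> is the real part of \<open>b + i k\<close>, which is \<open>sqrt c\<close> times a
  unitary.\<close>

lemma norm_le_of_herm_square: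
  fixes a :: "'a::unital_cstar_algebra"
  assumes a: "herm_square a" and ca: "herm_square (c *\<^sub>R 1 - a)" and c: "0 \<le> c"
  shows "norm a \<le> c"
proof -
  obtain b where b: "b\<^sup>\<star> = b" "b * b = a" "\<And>y. a * y = y * a \<Longrightarrow> b * y = y * b"
    using herm_square_sqrt[OF a] by blast
  obtain k where k: "k\<^sup>\<star> = k" "k * k = c *\<^sub>R 1 - a"
      "\<And>y. (c *\<^sub>R 1 - a) * y = y * (c *\<^sub>R 1 - a) \<Longrightarrow> k * y = y * k"
    using herm_square_sqrt[OF ca] by blast
  have "k * a = a * k" by (rule k(3)) (simp add: left_diff_distrib right_diff_distrib)
  hence bk: "k * b = b * k" using b(3)[of k] by simp
  define u where "u = b + \<i> *\<^sub>C k"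
  have ua: "u\<^sup>\<star> = b - \<i> *\<^sub>C k" by (simp add: u_def adj_simps b k scaleC_minus_left)
  have "u\<^sup>\<star> * u = c *\<^sub>R 1"
    unfolding ua unfolding u_def
    by (simp add: distrib_left left_diff_distrib b(2)
        mult_scaleC_left mult_scaleC_right scaleC_scaleC scaleC_minus_left scaleC_diff_right scaleC_add_right k(2) bk)
  hence "norm (u\<^sup>\<star> * u) \<le> (sqrt c)\<^sup>2" using c by simp
  hence nu: "norm u \<le> sqrt c" using norm_square_le c real_sqrt_ge_zero by blast
  have "u + u\<^sup>\<star> = 2 *\<^sub>R b" unfolding ua unfolding u_def by (simp add: scaleR_2)
  hence "norm (2 *\<^sub>R b) \<le> norm u + norm (u\<^sup>\<star>)" by (metis norm_triangle_ineq)
  hence "norm b \<le> sqrt c" using nu by simp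
  hence "(norm b)\<^sup>2 \<le> c" using c by (metis norm_ge_zero power_mono real_sqrt_pow2)
  thus ?thesis using norm_square[OF b(1)] b(2) by simp
qed

lemma herm_square_antisym:
  fixes a :: "'a::unital_cstar_algebra"
  assumes "herm_square a" "herm_square (- a)"
  shows "a = 0"
  using norm_le_of_herm_square[of a 0] assms by simp

text \<open>The fourth power of \<open>n\<close> vanishes as well, and the C*-identity is applied
  twice.\<close>

lemma cube_eq_0:
  fixes n :: "'a::unital_cstar_algebra"
  assumes n: "n\<^sup>\<star> = n" and "n * n * n = 0"
  shows "n = 0"
proof -
  have "(n * n)\<^sup>\<star> * (n * n) = 0"
    using assms by (simp add: adj_mult mult.assoc[symmetric])
  hence "n\<^sup>\<star> * n = 0" using adj_mult_eq_0 n by metis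
  thus ?thesis by (rule adj_mult_eq_0)
qed

text \<open>Here \<open>n\<close> is the negative part \<open>(|h| - h) / 2\<close> of \<open>h\<close>.\<close>

lemma negative_part:
  fixes h :: "'a::unital_cstar_algebra"
  assumes h: "h\<^sup>\<star> = h"
  obtains n where "n\<^sup>\<star> = n" "n * h * n = - (n * n * n)" "herm_square (n * n * n)"
    "n = 0 \<Longrightarrow> herm_square h"
proof -
  have "herm_square (h * h)" using h by (rule herm_squareI)
  then obtain a where a: "a\<^sup>\<star> = a" "a * a = h * h" "norm (sqrt (norm (h * h)) *\<^sub>R 1 - a) \<le> sqrt (norm (h * h))"
      "\<And>y. (h * h) * y = y * (h * h) \<Longrightarrow> a * y = y * a"
    using sqrt_of_norm_diff_le herm_square_iff_norm by metis
  have ah: "a * h = h * a" by (rule a(4)) (simp add: mult.assoc)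
  \<comment> \<open>The norm bound makes the chosen root \<open>a\<close> of \<open>h * h\<close>
    positive, so it serves as the absolute value of \<open>h\<close>.\<close>
  have ha: "herm_square a" using a(1,3) by (rule herm_squareI_norm)
  then obtain r where r: "r\<^sup>\<star> = r" "r * r = a" "\<And>y. a * y = y * a \<Longrightarrow> r * y = y * r"
    using herm_square_sqrt by blast
  define n where "n = (1/2) *\<^sub>R (a - h)"
  have n: "n\<^sup>\<star> = n" by (simp add: n_def adj_simps a h)
  have "(a - h) * (a - h) = 2 *\<^sub>R (a * (a - h))"
    by (simp add: left_diff_distrib right_diff_distrib a(2) ah scaleR_2)
  hence an: "n * n = a * n" by (simp add: n_def)
  have "a * (a - h) = - (h * (a - h))" by (simp add: right_diff_distrib a(2) ah)
  hence "n * n = - (h * n)" unfolding an by (simp add: n_def)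
  hence hn: "h * n = - (n * n)" by simp
  have rn: "r * n = n * r"
    by (rule r(3)) (simp add: n_def left_diff_distrib right_diff_distrib ah)
  show ?thesis
  proof (rule that[OF n])
    show "n * h * n = - (n * n * n)" by (simp add: hn mult.assoc)
    \<comment> \<open>As \<open>n * n = a * n\<close> and \<open>r\<close> is a root of
      \<open>a\<close> that commutes with \<open>n\<close>, the cube of \<open>n\<close> is the
      square of \<open>n * r\<close>.\<close>
    have "(n * r) * (n * r) = n * (r * n) * r" by (simp only: mult.assoc)
    also have "\<dots> = n * (n * (r * r))" by (simp only: rn mult.assoc)
    also have "\<dots> = n * (n * a)" by (simp only: r(2))
    also have "n * a = a * n" by (simp add: n_def left_diff_distrib right_diff_distrib ah)
    finally have "(n * r) * (n * r) = n * n * n" by (simp only: an[symmetric] mult.assoc)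
    thus "herm_square (n * n * n)" using herm_squareI[of "n * r"] by (simp add: adj_mult n r rn)
    show "herm_square h" if "n = 0" using that ha by (simp add: n_def)
  qed
qed

text \<open>Normalize \<open>c\<close> and put \<open>m = - c\<^sup>\<star> c\<close>. As \<open>p = c c\<^sup>\<star>\<close> is a positive contraction, so is \<open>1 - p\<close>, and
  \<open>(1 - p) c = c (1 + m)\<close> forces \<open>m (1 + m)\<^sup>2 \<le> 1\<close>, which contradicts \<open>\<parallel>m\<parallel> = 1\<close>.\<close>

lemma adj_mult_eq_minus_herm_square:
  fixes c :: "'a::unital_cstar_algebra"
  assumes "herm_square (- (c\<^sup>\<star> * c))"
  shows "c = 0"
proof (rule ccontr)
  assume c: "c \<noteq> 0"
  define d where "d = (1 / norm c) *\<^sub>R c"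
  have nd: "norm d = 1" using c by (simp add: d_def)
  define m where "m = - (d\<^sup>\<star> * d)"
  have dd: "d\<^sup>\<star> * d = - m" by (simp add: m_def)
  have "m = (1 / norm c * (1 / norm c)) *\<^sub>R (- (c\<^sup>\<star> * c))" by (simp add: m_def d_def adj_scaleR)
  hence hm: "herm_square m" using assms by (metis herm_square_scaleR zero_le_square)
  then obtain k where k: "k\<^sup>\<star> = k" "m = k * k" unfolding herm_square_def by blast
  have m: "m\<^sup>\<star> = m" using hm by (rule herm_square_adj)
  have nm: "norm m = 1" by (simp add: m_def cstar_identity nd)
  define p where "p = d * d\<^sup>\<star>"
  have np: "norm p = 1" using cstar_identity[of "d\<^sup>\<star>"] by (simp add: p_def nd adj_adj)
  \<comment> \<open>Up to sign, \<open>x\<close> and \<open>y\<close> are twice the real and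
    imaginary parts of \<open>d\<close>. The sum of their squares is \<open>2 (p - m)\<close>, which
    writes \<open>p\<close> as a sum of positive terms.\<close>
  define x where "x = d + d\<^sup>\<star>"
  define y where "y = \<i> *\<^sub>C (d - d\<^sup>\<star>)"
  have x: "x\<^sup>\<star> = x" by (simp add: x_def adj_simps)
  have y: "y\<^sup>\<star> = y" by (simp add: y_def adj_simps scaleC_minus_left scaleC_diff_right)
  have "x * x + y * y = 2 *\<^sub>R (d * d\<^sup>\<star> + d\<^sup>\<star> * d)"
    by (simp add: x_def y_def mult_scaleC_left mult_scaleC_right scaleC_scaleC scaleC_minus_left
        scaleC_diff_right scaleC_add_right distrib_left distrib_right left_diff_distrib right_diff_distrib scaleR_2)
  hence "p = (1/2) *\<^sub>R (x * x) + (1/2) *\<^sub>R (y * y) + m"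
    by (simp add: p_def dd scaleR_add_right[symmetric])
  hence hp: "herm_square p"
    using herm_squareI[OF x] herm_squareI[OF y] hm by (simp add: herm_square_add herm_square_scaleR)
  hence n1p: "norm (1 - p) \<le> 1" by (simp add: herm_square_iff_norm np)
  have "(1 - p) * d = d + d * m"
    using arg_cong[OF dd, of "\<lambda>z. d * z"] by (simp add: p_def left_diff_distrib mult.assoc)
  hence "norm (d + d * m) \<le> norm (1 - p) * norm d" by (metis norm_mult_ineq)
  hence ndm: "norm (d + d * m) \<le> 1" using n1p nd by simp
  \<comment> \<open>\<open>s\<close> is \<open>m\<close> times the square of \<open>1 + m\<close>;
    its negative is the product of the adjoint of \<open>d + d * m\<close> with
    \<open>d + d * m\<close>.\<close>
  define s where "s = m + 2 *\<^sub>R (m * m) + m * m * m"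
  have s: "s\<^sup>\<star> = s" by (simp add: s_def adj_simps m mult.assoc)
  have "(d + d * m)\<^sup>\<star> * (d + d * m) = (1 + m) * (d\<^sup>\<star> * d) * (1 + m)"
    by (simp add: adj_simps m distrib_left distrib_right mult.assoc)
  also have "\<dots> = - s"
    unfolding dd s_def by (simp add: distrib_left distrib_right left_diff_distrib mult.assoc scaleR_2)
  finally have "norm s = (norm (d + d * m))\<^sup>2" by (metis cstar_identity norm_minus_cancel)
  hence "norm s \<le> 1" using ndm by (simp add: power_le_one)
  hence "herm_square (1 - s)" using sqrt_one_minus[OF s] herm_squareI by metis
  moreover have "herm_square (m * m * m)"
  proof -
    have "m * m * m = (k * k * k) * (k * k * k)" by (simp add: k mult.assoc)
    thus ?thesis using herm_squareI[of "k * k * k"] k(1) by (simp add: adj_mult mult.assoc)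
  qed
  \<comment> \<open>Adding the positive terms \<open>m\<close> and \<open>m * m * m\<close> to
    \<open>1 - s\<close> leaves \<open>1 - 2 (m * m)\<close>, which bounds the norm of
    \<open>2 (m * m)\<close> by 1.\<close>
  ultimately have "herm_square ((1 - s) + m + m * m * m)" using hm by (simp add: herm_square_add)
  moreover have "(1 - s) + m + m * m * m = 1 *\<^sub>R 1 - 2 *\<^sub>R (m * m)" by (simp add: s_def)
  ultimately have "norm (2 *\<^sub>R (m * m)) \<le> 1"
    by (intro norm_le_of_herm_square herm_square_scaleR herm_squareI m) simp_all
  thus False by (simp add: norm_square[OF m] nm)
qed

text \<open>Let \<open>n\<close> be the negative part. Compressing by \<open>n\<close> gives the
  element \<open>- (n * n * n)\<close>, which has the form treated in
  \<open>adj_mult_eq_minus_herm_square\<close> with \<open>c = b * n\<close>; so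
  \<open>b * n = 0\<close>, and \<open>n\<close> vanishes.\<close>

lemma herm_square_adj_mult:
  fixes b :: "'a::unital_cstar_algebra"
  shows "herm_square (b\<^sup>\<star> * b)"
proof -
  have "(b\<^sup>\<star> * b)\<^sup>\<star> = b\<^sup>\<star> * b" by (simp add: adj_simps)
  then obtain n where n: "n\<^sup>\<star> = n" "n * (b\<^sup>\<star> * b) * n = - (n * n * n)" "herm_square (n * n * n)"
      "n = 0 \<Longrightarrow> herm_square (b\<^sup>\<star> * b)"
    using negative_part by blast
  have bn: "(b * n)\<^sup>\<star> * (b * n) = - (n * n * n)"
    using n(2) by (simp add: adj_mult n(1) mult.assoc)
  hence "b * n = 0" using n(3) by (intro adj_mult_eq_minus_herm_square) simp
  hence "n * n * n = 0" using bn by simp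
  thus ?thesis using cube_eq_0 n by blast
qed

lemma positive_iff_herm_square: "positive a \<longleftrightarrow> herm_square a"
  using herm_square_adj_mult unfolding positive_def herm_square_def by metis

lemma positive_adj_mult [intro]: "positive (b\<^sup>\<star> * b)"
  unfolding positive_def by blast

lemma positive_zero [simp]: "positive (0::'a::unital_cstar_algebra)"
  using positive_adj_mult[of "0::'a"] by simp

lemma positive_add: "positive a \<Longrightarrow> positive b \<Longrightarrow> positive (a + b)"
  by (simp add: positive_iff_herm_square herm_square_add)

lemma positive_sum: "(\<And>i. i \<in> I \<Longrightarrow> positive (f i)) \<Longrightarrow> positive (sum f I)"
  by (induction I rule: infinite_finite_induct) (simp_all add: positive_add)

lemma positive_scaleR: "positive a \<Longrightarrow> 0 \<le> r \<Longrightarrow> positive (r *\<^sub>R a)"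
  by (simp add: positive_iff_herm_square herm_square_scaleR)

lemma positive_conj: "positive a \<Longrightarrow> positive (c\<^sup>\<star> * a * c)"
  unfolding positive_def by (metis adj_mult mult.assoc)

lemma positive_antisym: "positive a \<Longrightarrow> positive (- a) \<Longrightarrow> a = 0"
  by (simp add: positive_iff_herm_square herm_square_antisym)

lemma norm_le_of_positive: "positive a \<Longrightarrow> positive (c *\<^sub>R 1 - a) \<Longrightarrow> 0 \<le> c \<Longrightarrow> norm a \<le> c"
  by (simp add: positive_iff_herm_square norm_le_of_herm_square)

lemma positive_norm_diff:
  fixes a :: "'a::unital_cstar_algebra"
  assumes a: "a\<^sup>\<star> = a" and na: "norm a \<le> r"
  shows "positive (r *\<^sub>R 1 - a)"
  unfolding positive_iff_herm_square
  by (rule herm_squareI_norm[of _ r]) (simp_all add: adj_simps a na)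

lemma closed_positive: "closed {a::'a::unital_cstar_algebra. positive a}"
  unfolding positive_iff_herm_square herm_square_iff_norm
  by (intro closed_Collect_conj closed_Collect_eq closed_Collect_le continuous_intros
      linear_continuous_on bounded_linear_adj)

section \<open>The order given by positivity\<close>

definition cle :: "'a::unital_cstar_algebra \<Rightarrow> 'a \<Rightarrow> bool" (infix "\<preceq>" 50) where
  "a \<preceq> b \<longleftrightarrow> positive (b - a)"

lemma cle_refl [simp]: "a \<preceq> a"
  by (simp add: cle_def)

lemma cle_trans [trans]: "a \<preceq> b \<Longrightarrow> b \<preceq> c \<Longrightarrow> a \<preceq> c"
  unfolding cle_def using positive_add[of "b - a" "c - b"] by simp

lemma cle_add: "a \<preceq> b \<Longrightarrow> c \<preceq> d \<Longrightarrow> a + c \<preceq> b + d"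
  unfolding cle_def using positive_add[of "b - a" "d - c"] by (simp add: algebra_simps)

lemma cle_sum: "(\<And>i. i \<in> I \<Longrightarrow> f i \<preceq> g i) \<Longrightarrow> sum f I \<preceq> sum g I"
  by (induction I rule: infinite_finite_induct) (simp_all add: cle_add)

lemma cle_scaleR: "a \<preceq> b \<Longrightarrow> 0 \<le> r \<Longrightarrow> r *\<^sub>R a \<preceq> r *\<^sub>R b"
  unfolding cle_def using positive_scaleR[of "b - a" r] by (simp add: scaleR_diff_right)

lemma scaleR_cle: "positive a \<Longrightarrow> r \<le> s \<Longrightarrow> r *\<^sub>R a \<preceq> s *\<^sub>R a"
  unfolding cle_def by (simp add: positive_scaleR flip: scaleR_diff_left)

lemma cle_sum_subset:
  assumes "K \<subseteq> I" "finite I" "\<And>i. i \<in> I \<Longrightarrow> positive (f i)"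
  shows "sum f K \<preceq> sum f I"
  unfolding cle_def using assms by (subst sum_diff[symmetric]) (auto intro: positive_sum)

lemma adj_mult_add_cle:
  fixes a b :: "'a::unital_cstar_algebra"
  shows "(a + b)\<^sup>\<star> * (a + b) \<preceq> 2 *\<^sub>R (a\<^sup>\<star> * a) + 2 *\<^sub>R (b\<^sup>\<star> * b)"
proof -
  have "2 *\<^sub>R (a\<^sup>\<star> * a) + 2 *\<^sub>R (b\<^sup>\<star> * b) - (a + b)\<^sup>\<star> * (a + b) = (a - b)\<^sup>\<star> * (a - b)"
    by (simp add: adj_simps scaleR_2 algebra_simps)
  thus ?thesis unfolding cle_def by (metis positive_adj_mult)
qed

text \<open>Cauchy-Schwarz against the constant family 1: the defect is half the sum of the squares
  of all differences \<open>y i - y j\<close>.\<close>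

lemma adj_mult_sum_cle:
  fixes y :: "'i \<Rightarrow> 'a::unital_cstar_algebra"
  shows "(\<Sum>i\<in>K. y i)\<^sup>\<star> * (\<Sum>i\<in>K. y i) \<preceq> real (card K) *\<^sub>R (\<Sum>i\<in>K. (y i)\<^sup>\<star> * y i)"
proof -
  let ?Q = "\<Sum>i\<in>K. (y i)\<^sup>\<star> * y i" and ?S = "\<Sum>i\<in>K. y i"
  have S: "(\<Sum>i\<in>K. \<Sum>j\<in>K. (y i)\<^sup>\<star> * y j) = ?S\<^sup>\<star> * ?S" by (simp add: adj_sum sum_product)
  moreover have "(\<Sum>i\<in>K. \<Sum>j\<in>K. (y j)\<^sup>\<star> * y i) = ?S\<^sup>\<star> * ?S"
    by (subst sum.swap) (rule S)
  moreover have "(\<Sum>i\<in>K. \<Sum>j\<in>K. (y i - y j)\<^sup>\<star> * (y i - y j))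
      = (\<Sum>i\<in>K. \<Sum>j\<in>K. (y i)\<^sup>\<star> * y i) + (\<Sum>i\<in>K. \<Sum>j\<in>K. (y j)\<^sup>\<star> * y j)
        - (\<Sum>i\<in>K. \<Sum>j\<in>K. (y i)\<^sup>\<star> * y j) - (\<Sum>i\<in>K. \<Sum>j\<in>K. (y j)\<^sup>\<star> * y i)"
    by (simp add: adj_diff left_diff_distrib right_diff_distrib sum_subtractf sum.distrib algebra_simps)
  moreover have "(\<Sum>i\<in>K. \<Sum>j\<in>K. (y i)\<^sup>\<star> * y i) = real (card K) *\<^sub>R ?Q"
    by (simp add: sum_constant_scaleR scaleR_sum_right del: sum_constant)
  moreover have "(\<Sum>i\<in>K. \<Sum>j\<in>K. (y j)\<^sup>\<star> * y j) = real (card K) *\<^sub>R ?Q"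
    by (simp add: sum_constant_scaleR del: sum_constant)
  ultimately have "(\<Sum>i\<in>K. \<Sum>j\<in>K. (y i - y j)\<^sup>\<star> * (y i - y j))
      = 2 *\<^sub>R (real (card K) *\<^sub>R ?Q - ?S\<^sup>\<star> * ?S)"
    by (simp add: scaleR_2)
  hence "real (card K) *\<^sub>R ?Q - ?S\<^sup>\<star> * ?S
      = (1/2) *\<^sub>R (\<Sum>i\<in>K. \<Sum>j\<in>K. (y i - y j)\<^sup>\<star> * (y i - y j))"
    by simp
  thus ?thesis unfolding cle_def by (auto intro!: positive_scaleR positive_sum)
qed

section \<open>Linear and positive maps\<close>

lemma clinear_add: "clinear f \<Longrightarrow> f (x + y) = f x + f y"
  and clinear_scaleC: "clinear f \<Longrightarrow> f (c *\<^sub>C x) = c *\<^sub>C f x"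
  and clinear_scaleR: "clinear f \<Longrightarrow> f (r *\<^sub>R x) = r *\<^sub>R f x"
  by (simp_all add: clinear_def scaleR_scaleC)

lemma clinear_zero: "clinear f \<Longrightarrow> f 0 = 0"
  using clinear_scaleC[of f 0 0] by simp

lemma clinear_minus: "clinear f \<Longrightarrow> f (- x) = - f x"
  using clinear_scaleC[of f "-1" x] by (simp add: scaleC_minus_left)

lemma clinear_diff: "clinear f \<Longrightarrow> f (x - y) = f x - f y"
  using clinear_add[of f x "-y"] by (simp add: clinear_minus)

lemma clinear_sum: "clinear f \<Longrightarrow> f (sum g I) = (\<Sum>i\<in>I. f (g i))"
  by (induction I rule: infinite_finite_induct) (simp_all add: clinear_zero clinear_add)

lemmas clinear_simps = clinear_add clinear_scaleC clinear_scaleR clinear_zero clinear_minus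
  clinear_diff clinear_sum

text \<open>For self-adjoint \<open>x\<close>, positivity and \<open>f 1 = 1\<close> squeeze
  \<open>f x\<close> between minus and plus \<open>norm x\<close>; a general \<open>x\<close> is
  split into real and imaginary part. Only continuity matters later, so the constants 3 and 6 are
  crude.\<close>

lemma bounded_linear_positive_map:
  fixes f :: "'a::unital_cstar_algebra \<Rightarrow> 'b::unital_cstar_algebra"
  assumes lin: "clinear f" and pos: "\<And>x. positive x \<Longrightarrow> positive (f x)" and one: "f 1 = 1"
  shows "bounded_linear f"
proof -
  note [simp] = clinear_simps[OF lin]
  have sa: "norm (f x) \<le> 3 * norm x" if x: "x\<^sup>\<star> = x" for x
  proof -
    let ?r = "norm x"
    have "positive (f (?r *\<^sub>R 1 - (- x)))" "positive (f (?r *\<^sub>R 1 - x))"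
      by (intro pos positive_norm_diff; simp only: x adj_minus norm_minus_cancel)+
    hence p: "positive (?r *\<^sub>R 1 + f x)" "positive (?r *\<^sub>R 1 - f x)" by (simp_all add: one)
    have eq: "(2 * ?r) *\<^sub>R 1 - (?r *\<^sub>R 1 + f x) = ?r *\<^sub>R 1 - f x"
      by (simp add: scaleR_scaleR[symmetric] scaleR_2 del: scaleR_scaleR)
    hence "norm (?r *\<^sub>R 1 + f x) \<le> 2 * ?r"
      using p by (intro norm_le_of_positive) (simp_all only: eq, simp)
    moreover have "norm (f x) \<le> norm (?r *\<^sub>R 1 + f x) + norm (?r *\<^sub>R 1 :: 'b)"
      using norm_triangle_ineq4[of "?r *\<^sub>R 1 + f x" "?r *\<^sub>R 1"] by simp
    ultimately show ?thesis by simp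
  qed
  have "norm (f x) \<le> norm x * 6" for x
  proof -
    define u where "u = (1/2) *\<^sub>R (x + x\<^sup>\<star>)"
    define v where "v = (1/2) *\<^sub>R (\<i> *\<^sub>C (x\<^sup>\<star> - x))"
    have u: "u\<^sup>\<star> = u" by (simp add: u_def adj_simps add.commute)
    have v: "v\<^sup>\<star> = v" by (simp add: v_def adj_simps scaleC_minus_left scaleC_diff_right)
    have nu: "norm u \<le> norm x" using norm_triangle_ineq[of x "x\<^sup>\<star>"] by (simp add: u_def)
    have nv: "norm v \<le> norm x"
      using norm_triangle_ineq4[of "x\<^sup>\<star>" x] by (simp add: v_def norm_scaleC)
    have "\<i> *\<^sub>C v = (1/2) *\<^sub>R (x - x\<^sup>\<star>)"
      by (simp add: v_def scaleR_scaleC scaleC_scaleC scaleC_minus_left scaleC_diff_right)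
    hence "u + \<i> *\<^sub>C v = (1/2) *\<^sub>R (2 *\<^sub>R x)"
      by (simp only: u_def scaleR_add_right[symmetric] scaleR_2) simp
    hence "f (u + \<i> *\<^sub>C v) = f x" by simp
    hence "f x = f u + \<i> *\<^sub>C f v" by simp
    hence "norm (f x) \<le> norm (f u) + norm (f v)"
      by (metis mult_1 norm_ii norm_scaleC norm_triangle_ineq)
    thus ?thesis using sa[OF u] sa[OF v] nu nv by linarith
  qed
  thus ?thesis by (intro bounded_linear_intro[of f 6]) simp_all
qed

lemma positive_complexI: "(z::complex) \<in> \<real>\<^sub>\<ge>\<^sub>0 \<Longrightarrow> positive z"
proof -
  assume "z \<in> \<real>\<^sub>\<ge>\<^sub>0"
  then obtain r where "0 \<le> r" "z = of_real r" by (auto simp: nonneg_Reals_def)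
  hence "z = (of_real (sqrt r))\<^sup>\<star> * of_real (sqrt r)"
    by (simp add: adj_complex_def flip: of_real_mult)
  thus ?thesis by (metis positive_adj_mult)
qed

lemma state_bounded_linear: "state \<phi> \<Longrightarrow> bounded_linear \<phi>"
  by (rule bounded_linear_positive_map) (auto simp: state_def intro: positive_complexI)

lemma star_hom_bounded_linear:
  fixes f :: "'a::unital_cstar_algebra \<Rightarrow> 'b::unital_cstar_algebra"
  assumes "unital_star_hom f"
  shows "bounded_linear f"
proof (rule bounded_linear_positive_map)
  fix x :: 'a assume "positive x"
  thus "positive (f x)" using assms unfolding positive_def unital_star_hom_def by metis
qed (use assms in \<open>auto simp: unital_star_hom_def\<close>)

text \<open>A faithful expectation detects the norm of the left regular representation.\<close>

lemma norm_le_of_faithful: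
  fixes E :: "'b::unital_cstar_algebra \<Rightarrow> 'a::unital_cstar_algebra"
  assumes lin: "clinear E" and pos: "\<And>x. positive x \<Longrightarrow> positive (E x)" and faithful: "faithful E"
    and le: "\<And>y. E ((x * y)\<^sup>\<star> * (x * y)) \<preceq> s *\<^sub>R E (y\<^sup>\<star> * y)" and s: "0 \<le> s"
  shows "(norm x)\<^sup>2 \<le> s"
proof -
  note [simp] = clinear_simps[OF lin]
  define k where "k = s *\<^sub>R 1 - x\<^sup>\<star> * x"
  have "k\<^sup>\<star> = k" by (simp add: k_def adj_simps)
  \<comment> \<open>For \<open>y = n\<close>, the negative part of \<open>k\<close>, the hypothesis
    says that \<open>- E (n * n * n)\<close> is positive. Faithfulness then forces
    \<open>n = 0\<close>, so \<open>k\<close> is positive.\<close>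
  then obtain n where n: "n\<^sup>\<star> = n" "n * k * n = - (n * n * n)" "herm_square (n * n * n)"
      "n = 0 \<Longrightarrow> herm_square k"
    using negative_part by blast
  have "s *\<^sub>R E (n\<^sup>\<star> * n) - E ((x * n)\<^sup>\<star> * (x * n)) = E (n * k * n)"
    by (simp add: k_def adj_mult n(1) left_diff_distrib right_diff_distrib mult.assoc)
  hence "positive (- E (n * n * n))" using le[of n] n(2) by (simp add: cle_def)
  moreover have nnn: "positive (n * n * n)" using n(3) by (simp add: positive_iff_herm_square)
  ultimately have "E (n * n * n) = 0" using pos positive_antisym by blast
  hence "n * n * n = 0" using faithful nnn unfolding faithful_def by blast
  hence "positive k" using n(4) cube_eq_0[OF n(1)] by (simp add: positive_iff_herm_square)
  hence "norm (x\<^sup>\<star> * x) \<le> s" unfolding k_def using s by (intro norm_le_of_positive) auto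
  thus ?thesis by (simp add: cstar_identity)
qed

section \<open>Reduced crossed products\<close>

text \<open>The expectation, which \<open>is_reduced_crossed_product\<close> only asserts to exist,
  becomes a parameter, so that components and the inner product can be defined from it.\<close>

locale reduced_crossed_product = twisted_cstar_system G \<alpha> \<sigma>
  for G :: "('g, 'm) monoid_scheme" (structure)
    and \<alpha> :: "'g \<Rightarrow> 'a::unital_cstar_algebra \<Rightarrow> 'a"
    and \<sigma> :: "'g \<Rightarrow> 'g \<Rightarrow> 'a" +
  fixes \<iota> :: "'a \<Rightarrow> 'b::unital_cstar_algebra"
    and l :: "'g \<Rightarrow> 'b"
    and E :: "'b \<Rightarrow> 'a"
  assumes hom_\<iota>: "unital_star_hom \<iota>"
    and unitary_l: "g \<in> carrier G \<Longrightarrow> unitary (l g)"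
    and generated: "cstar_generated (range \<iota> \<union> l ` carrier G) = UNIV"
    and covariance: "g \<in> carrier G \<Longrightarrow> \<iota> (\<alpha> g a) = l g * \<iota> a * (l g)\<^sup>\<star>"
    and l_mult: "g \<in> carrier G \<Longrightarrow> h \<in> carrier G \<Longrightarrow> l g * l h = \<iota> (\<sigma> g h) * l (g \<otimes> h)"
    and expectation: "conditional_expectation \<iota> E"
    and faithful: "faithful E"
    and E_l: "g \<in> carrier G \<Longrightarrow> g \<noteq> \<one> \<Longrightarrow> E (l g) = 0"
begin

lemma clinear_\<iota>: "clinear \<iota>"
  using hom_\<iota> by (simp add: unital_star_hom_def)

lemma clinear_E: "clinear E"
  using expectation by (simp add: conditional_expectation_def)

lemmas \<iota>_linear [simp] = clinear_simps[OF clinear_\<iota>]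
lemmas E_linear [simp] = clinear_simps[OF clinear_E]

lemma \<iota>_mult [simp]: "\<iota> (a * b) = \<iota> a * \<iota> b"
  and \<iota>_adj [simp]: "\<iota> (a\<^sup>\<star>) = (\<iota> a)\<^sup>\<star>"
  and \<iota>_one [simp]: "\<iota> 1 = 1"
  using hom_\<iota> by (simp_all add: unital_star_hom_def)

lemma E_\<iota> [simp]: "E (\<iota> a) = a"
  using expectation by (simp add: conditional_expectation_def)

lemma E_positive: "positive x \<Longrightarrow> positive (E x)"
  using expectation by (simp add: conditional_expectation_def)

lemma E_bimodule: "E (\<iota> a * x * \<iota> b) = a * E x * b"
  using expectation by (simp add: conditional_expectation_def)

lemma E_left: "E (\<iota> a * x) = a * E x"
  using E_bimodule[of a x 1] by simp

lemma E_right: "E (x * \<iota> b) = E x * b"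
  using E_bimodule[of 1 x b] by simp

lemma E_one [simp]: "E 1 = 1"
  using E_\<iota>[of 1] by simp

lemma bounded_linear_\<iota>: "bounded_linear \<iota>"
  by (rule star_hom_bounded_linear[OF hom_\<iota>])

lemma bounded_linear_E: "bounded_linear E"
  by (rule bounded_linear_positive_map[OF clinear_E E_positive E_one])

lemma l_unitary [simp]:
  assumes "g \<in> carrier G"
  shows "(l g)\<^sup>\<star> * l g = 1" "l g * (l g)\<^sup>\<star> = 1"
    "(l g)\<^sup>\<star> * (l g * x) = x" "l g * ((l g)\<^sup>\<star> * x) = x"
  using unitary_l[OF assms] by (simp_all add: unitary_def mult.assoc[symmetric])

lemma norm_l [simp]: "g \<in> carrier G \<Longrightarrow> norm (l g) = 1"
  by (simp add: norm_unitary unitary_l)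

lemma l_one [simp]: "l \<one> = 1"
proof -
  have "l \<one> * l \<one> = l \<one>" using l_mult[of \<one> \<one>] normalized(1)[of \<one>] by simp
  hence "(l \<one>)\<^sup>\<star> * (l \<one> * l \<one>) = (l \<one>)\<^sup>\<star> * l \<one>" by simp
  thus ?thesis by simp
qed

lemma l_\<iota>: "g \<in> carrier G \<Longrightarrow> l g * \<iota> a = \<iota> (\<alpha> g a) * l g"
  by (simp add: covariance mult.assoc)

section \<open>The grading by the group and Fourier components\<close>

definition homogeneous :: "'g \<Rightarrow> 'b \<Rightarrow> bool" where
  "homogeneous g x \<longleftrightarrow> (\<exists>a. x = \<iota> a * l g)"

lemma homogeneous_l: "homogeneous g (l g)"
  unfolding homogeneous_def by (rule exI[of _ 1]) simp

lemma homogeneous_\<iota>: "homogeneous \<one> (\<iota> a)"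
  unfolding homogeneous_def by (rule exI[of _ a]) simp

lemma homogeneous_mult:
  assumes "homogeneous g x" "homogeneous h y" and gh: "g \<in> carrier G" "h \<in> carrier G"
  shows "homogeneous (g \<otimes> h) (x * y)"
proof -
  obtain a b where x: "x = \<iota> a * l g" and y: "y = \<iota> b * l h"
    using assms unfolding homogeneous_def by blast
  have "x * y = \<iota> a * (l g * \<iota> b) * l h" by (simp add: x y mult.assoc)
  also have "\<dots> = \<iota> (a * \<alpha> g b) * (l g * l h)" by (simp add: l_\<iota> gh mult.assoc)
  also have "\<dots> = \<iota> (a * \<alpha> g b * \<sigma> g h) * l (g \<otimes> h)" by (simp add: l_mult gh mult.assoc)
  finally show ?thesis unfolding homogeneous_def by blast
qed

text \<open>With a twist, the adjoint of \<open>l g\<close> equals \<open>l (inv g)\<close> only up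
  to the unitary \<open>\<sigma> (inv g) g\<close> of \<open>A\<close>.\<close>

lemma homogeneous_adj:
  assumes "homogeneous g x" and g: "g \<in> carrier G"
  shows "homogeneous (inv g) (x\<^sup>\<star>)"
proof -
  have "l (inv g) * l g = \<iota> (\<sigma> (inv g) g)" using l_mult[of "inv g" g] g by simp
  hence "l (inv g) * (l g * (l g)\<^sup>\<star>) = \<iota> (\<sigma> (inv g) g) * (l g)\<^sup>\<star>" by (simp add: mult.assoc[symmetric])
  hence "\<iota> (\<sigma> (inv g) g) * (l g)\<^sup>\<star> = l (inv g)" using g by simp
  hence "\<iota> ((\<sigma> (inv g) g)\<^sup>\<star> * \<sigma> (inv g) g) * (l g)\<^sup>\<star> = \<iota> ((\<sigma> (inv g) g)\<^sup>\<star>) * l (inv g)"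
    by (simp add: mult.assoc)
  hence "(l g)\<^sup>\<star> = \<iota> ((\<sigma> (inv g) g)\<^sup>\<star>) * l (inv g)"
    using unitary_cocycle[of "inv g" g] g by (simp add: unitary_def del: \<iota>_mult \<iota>_adj)
  hence 1: "homogeneous (inv g) ((l g)\<^sup>\<star>)" unfolding homogeneous_def by blast
  obtain a where x: "x = \<iota> a * l g" using assms unfolding homogeneous_def by blast
  show ?thesis
    using homogeneous_mult[OF 1 homogeneous_\<iota>[of "a\<^sup>\<star>"]] g by (simp add: x adj_mult)
qed

lemma homogeneous_conj:
  assumes "homogeneous g x" "g \<in> carrier G" "h \<in> carrier G"
  shows "homogeneous (h \<otimes> g \<otimes> inv h) (l h * x * (l h)\<^sup>\<star>)"
  using assms by (intro homogeneous_mult homogeneous_l homogeneous_adj) auto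

lemma E_homogeneous:
  assumes "homogeneous g x" "g \<in> carrier G" "g \<noteq> \<one>"
  shows "E x = 0"
  using assms unfolding homogeneous_def by (auto simp: E_left E_l)

text \<open>The Fourier coefficient of \<open>x\<close> at \<open>g\<close>, put back into the fibre
  over \<open>g\<close>.\<close>

definition component :: "'g \<Rightarrow> 'b \<Rightarrow> 'b" where
  "component g x = \<iota> (E (x * (l g)\<^sup>\<star>)) * l g"

lemma component_homogeneous: "homogeneous g (component g x)"
  unfolding homogeneous_def component_def by blast

lemma component_add: "component g (x + y) = component g x + component g y"
  and component_diff: "component g (x - y) = component g x - component g y"
  and component_zero [simp]: "component g 0 = 0"
  by (simp_all add: component_def distrib_right left_diff_distrib)

lemma component_sum: "component g (sum f I) = (\<Sum>i\<in>I. component g (f i))"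
  by (induction I rule: infinite_finite_induct) (simp_all add: component_add)

lemma component_one [simp]: "component \<one> x = \<iota> (E x)"
  by (simp add: component_def)

text \<open>For different \<open>g\<close> and \<open>h\<close> the product under \<open>E\<close>
  lies in the fibre over \<open>h \<otimes> inv g\<close>, which \<open>E\<close> kills.\<close>

lemma component_of_homogeneous:
  assumes x: "homogeneous h x" and gh: "g \<in> carrier G" "h \<in> carrier G"
  shows "component g x = (if g = h then x else 0)"
proof (cases "g = h")
  case True
  obtain a where x: "x = \<iota> a * l h" using x unfolding homogeneous_def by blast
  show ?thesis using True gh by (simp add: component_def x mult.assoc)
next
  case False
  have "homogeneous (h \<otimes> inv g) (x * (l g)\<^sup>\<star>)"
    using gh by (intro homogeneous_mult x homogeneous_adj homogeneous_l) auto
  moreover have "h \<otimes> inv g \<noteq> \<one>" using False gh by (metis inv_equality inv_inv inv_closed)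
  ultimately have "E (x * (l g)\<^sup>\<star>) = 0" using gh by (intro E_homogeneous) auto
  thus ?thesis using False by (simp add: component_def)
qed

text \<open>A finite Fourier expansion; \<open>M\<close> is an upper bound for the support and may
  contain points with zero component.\<close>

definition supported :: "'g set \<Rightarrow> 'b \<Rightarrow> bool" where
  "supported M x \<longleftrightarrow> finite M \<and> M \<subseteq> carrier G \<and> x = (\<Sum>g\<in>M. component g x)"

lemma supportedD:
  assumes "supported M x"
  shows "finite M" "M \<subseteq> carrier G" "(\<Sum>g\<in>M. component g x) = x"
  using assms unfolding supported_def by simp_all

lemma component_sum_homogeneous:
  assumes "finite M" "M \<subseteq> carrier G" "\<And>g. g \<in> M \<Longrightarrow> homogeneous g (f g)" "h \<in> carrier G"
  shows "component h (sum f M) = (if h \<in> M then f h else 0)"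
proof -
  have "component h (sum f M) = (\<Sum>g\<in>M. if g = h then f g else 0)"
    unfolding component_sum
    by (intro sum.cong refl) (auto simp: component_of_homogeneous[OF assms(3)] subsetD[OF assms(2)] assms(4))
  thus ?thesis using assms(1) by simp
qed

lemma supported_sum_homogeneous:
  assumes "finite M" "M \<subseteq> carrier G" "\<And>g. g \<in> M \<Longrightarrow> homogeneous g (f g)"
  shows "supported M (sum f M)"
  unfolding supported_def using assms
  by (auto simp: component_sum_homogeneous subset_iff intro!: sum.cong)

lemma component_outside:
  assumes "supported M x" "g \<in> carrier G" "g \<notin> M"
  shows "component g x = 0"
  using component_sum_homogeneous[of M "\<lambda>g. component g x" g] assms supportedD[OF assms(1)]
  by (simp add: component_homogeneous)

lemma supported_mono:
  assumes "supported M x" "M \<subseteq> M'" "finite M'" "M' \<subseteq> carrier G"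
  shows "supported M' x"
proof -
  have "(\<Sum>g\<in>M'. component g x) = (\<Sum>g\<in>M. component g x)"
    using assms by (intro sum.mono_neutral_right) (auto intro!: component_outside)
  thus ?thesis using assms unfolding supported_def by simp
qed

lemma supported_add: "supported M x \<Longrightarrow> supported M y \<Longrightarrow> supported M (x + y)"
  by (simp add: supported_def component_add sum.distrib)

lemma supported_zero: "finite M \<Longrightarrow> M \<subseteq> carrier G \<Longrightarrow> supported M 0"
  by (simp add: supported_def)

lemma supported_sum:
  assumes "finite M" "M \<subseteq> carrier G" "\<And>i. i \<in> I \<Longrightarrow> supported M (f i)"
  shows "supported M (sum f I)"
  using assms(3)
  by (induction I rule: infinite_finite_induct) (simp_all add: supported_zero assms supported_add)

lemma supported_homogeneous: "homogeneous g x \<Longrightarrow> g \<in> carrier G \<Longrightarrow> supported {g} x"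
  using supported_sum_homogeneous[of "{g}" "\<lambda>_. x"] by simp

lemma supported_scaleC: "supported M x \<Longrightarrow> supported M (c *\<^sub>C x)"
proof -
  assume x: "supported M x"
  \<comment> \<open>The scalar is moved into \<open>A\<close>, which makes every summand visibly
    homogeneous.\<close>
  have "c *\<^sub>C x = \<iota> (c *\<^sub>C 1) * (\<Sum>g\<in>M. component g x)"
    using supportedD(3)[OF x] by (simp add: mult_scaleC_left)
  also have "\<dots> = (\<Sum>g\<in>M. \<iota> (c *\<^sub>C 1 * E (x * (l g)\<^sup>\<star>)) * l g)"
    by (simp add: sum_distrib_left component_def mult.assoc)
  finally have eq: "c *\<^sub>C x = \<dots>" .
  show ?thesis unfolding eq using supportedD[OF x]
    by (intro supported_sum_homogeneous) (auto simp: homogeneous_def simp del: \<iota>_mult \<iota>_linear)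
qed

lemma set_mult_carrier: "M \<subseteq> carrier G \<Longrightarrow> N \<subseteq> carrier G \<Longrightarrow> M <#> N \<subseteq> carrier G"
  by (auto simp: set_mult_def)

lemma finite_set_mult: "finite M \<Longrightarrow> finite N \<Longrightarrow> finite (M <#> N)"
  by (simp add: set_mult_def)

lemma supported_mult:
  assumes x: "supported M x" and y: "supported N y"
  shows "supported (M <#> N) (x * y)"
proof -
  note fin = supportedD(1,2)[OF x] supportedD(1,2)[OF y]
  have "x * y = (\<Sum>g\<in>M. \<Sum>h\<in>N. component g x * component h y)"
    using supportedD(3)[OF x] supportedD(3)[OF y] by (metis sum_product)
  moreover have "supported (M <#> N) (component g x * component h y)" if "g \<in> M" "h \<in> N" for g h
  proof (rule supported_mono)
    show "supported {g \<otimes> h} (component g x * component h y)"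
      using that fin
      by (intro supported_homogeneous homogeneous_mult component_homogeneous) auto
  qed (use that fin in \<open>auto simp: finite_set_mult set_mult_carrier, auto simp: set_mult_def\<close>)
  ultimately show ?thesis
    using fin by (simp add: supported_sum finite_set_mult set_mult_carrier)
qed

lemma supported_adj:
  assumes x: "supported M x"
  shows "supported ((\<lambda>g. inv g) ` M) (x\<^sup>\<star>)"
proof -
  note fin = supportedD(1,2)[OF x]
  have "x\<^sup>\<star> = (\<Sum>g\<in>M. (component g x)\<^sup>\<star>)"
    using supportedD(3)[OF x] by (metis adj_sum)
  moreover have "supported ((\<lambda>g. inv g) ` M) ((component g x)\<^sup>\<star>)" if "g \<in> M" for g
  proof (rule supported_mono)
    show "supported {inv g} ((component g x)\<^sup>\<star>)"
      using that fin
      by (intro supported_homogeneous homogeneous_adj component_homogeneous) auto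
  qed (use that fin in auto)
  ultimately show ?thesis
    using fin by (auto intro!: supported_sum)
qed

lemma supported_diff_expectation:
  assumes x: "supported M x"
  shows "supported (M - {\<one>}) (x - \<iota> (E x))"
proof -
  note fin = supportedD(1,2)[OF x]
  \<comment> \<open>Adjoining the identity lets its component \<open>\<iota> (E x)\<close> be split
    off whether or not it belongs to \<open>M\<close>.\<close>
  have "supported (insert \<one> M) x" using fin by (intro supported_mono[OF x]) auto
  hence "x = (\<Sum>g\<in>insert \<one> M. component g x)" by (simp add: supported_def)
  also have "\<dots> = \<iota> (E x) + (\<Sum>g\<in>M - {\<one>}. component g x)"
    using fin by (subst sum.insert_remove) simp_all
  finally have "x - \<iota> (E x) = (\<Sum>g\<in>M - {\<one>}. component g x)" by (simp add: algebra_simps)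
  moreover have "supported (M - {\<one>}) (\<Sum>g\<in>M - {\<one>}. component g x)"
    using fin by (intro supported_sum_homogeneous component_homogeneous) auto
  ultimately show ?thesis by simp
qed

text \<open>The finitely supported elements form a *-algebra containing the generators, so their
  closure is a C*-subalgebra containing the generators.\<close>

lemma closure_supported: "closure {x. \<exists>M. supported M x} = UNIV"
proof -
  let ?S = "{x. \<exists>M. supported M x}"
  have add: "x + y \<in> ?S" if xy: "x \<in> ?S" "y \<in> ?S" for x y
  proof -
    obtain M N where MN: "supported M x" "supported N y" using xy by blast
    hence "supported (M \<union> N) x" "supported (M \<union> N) y"
      using supportedD(1,2)[OF MN(1)] supportedD(1,2)[OF MN(2)] by (auto intro: supported_mono)
    thus ?thesis using supported_add by blast
  qed
  have "cstar_subalgebra (closure ?S)"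
    unfolding cstar_subalgebra_def
  proof (intro conjI ballI allI)
    show "0 \<in> closure ?S" using supported_zero[of "{}"] closure_subset by fastforce
    fix x assume x: "x \<in> closure ?S"
    then obtain f where f: "\<And>n. f n \<in> ?S" "f \<longlonglongrightarrow> x" unfolding closure_sequential by blast
    show "c *\<^sub>C x \<in> closure ?S" for c
      unfolding closure_sequential
    proof (intro exI conjI allI)
      show "c *\<^sub>C f n \<in> ?S" for n using f(1)[of n] supported_scaleC by blast
      show "(\<lambda>n. c *\<^sub>C f n) \<longlonglongrightarrow> c *\<^sub>C x" by (intro tendsto_intros f)
    qed
    show "x\<^sup>\<star> \<in> closure ?S"
      unfolding closure_sequential
    proof (intro exI conjI allI)
      show "(f n)\<^sup>\<star> \<in> ?S" for n using f(1)[of n] supported_adj by blast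
      show "(\<lambda>n. (f n)\<^sup>\<star>) \<longlonglongrightarrow> x\<^sup>\<star>" by (intro tendsto_intros f)
    qed
    fix y assume y: "y \<in> closure ?S"
    then obtain g where g: "\<And>n. g n \<in> ?S" "g \<longlonglongrightarrow> y" unfolding closure_sequential by blast
    show "x + y \<in> closure ?S"
      unfolding closure_sequential
    proof (intro exI conjI allI)
      show "f n + g n \<in> ?S" for n using f(1)[of n] g(1)[of n] by (rule add)
      show "(\<lambda>n. f n + g n) \<longlonglongrightarrow> x + y" by (intro tendsto_intros f g)
    qed
    show "x * y \<in> closure ?S"
      unfolding closure_sequential
    proof (intro exI conjI allI)
      show "f n * g n \<in> ?S" for n using f(1)[of n] g(1)[of n] supported_mult by blast
      show "(\<lambda>n. f n * g n) \<longlonglongrightarrow> x * y" by (intro tendsto_intros f g)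
    qed
  qed simp
  moreover have "range \<iota> \<union> l ` carrier G \<subseteq> closure ?S"
    using supported_homogeneous[OF homogeneous_\<iota>] supported_homogeneous[OF homogeneous_l]
      closure_subset[of ?S] by blast
  ultimately have "cstar_generated (range \<iota> \<union> l ` carrier G) \<subseteq> closure ?S"
    unfolding cstar_generated_def by blast
  thus ?thesis using generated by blast
qed

lemma supported_approx:
  assumes "0 < \<epsilon>"
  obtains M y where "supported M y" "norm (x - y) < \<epsilon>"
proof -
  have "x \<in> closure {x. \<exists>M. supported M x}" using closure_supported by simp
  then obtain y where "y \<in> {x. \<exists>M. supported M x}" "dist y x < \<epsilon>"
    using assms unfolding closure_approachable by blast
  thus ?thesis using that by (auto simp: dist_norm norm_minus_commute)
qed

text \<open>Density as a proof principle for closed properties.\<close>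

lemma closed_supportedI:
  assumes "closed {x. P x}" "\<And>M x. supported M x \<Longrightarrow> P x"
  shows "P x"
proof -
  have "closure {x. \<exists>M. supported M x} \<subseteq> {x. P x}"
    using assms by (intro closure_minimal) auto
  thus ?thesis using closure_supported by auto
qed

section \<open>Estimates in the Hilbert module\<close>

text \<open>Pythagoras: distinct fibres are orthogonal for the inner product given by
  \<open>E\<close>.\<close>

lemma E_adj_mult_supported:
  assumes x: "supported M x"
  shows "E (x\<^sup>\<star> * x) = (\<Sum>g\<in>M. E ((component g x)\<^sup>\<star> * component g x))"
proof -
  note fin = supportedD(1,2)[OF x]
  have orth: "E ((component g x)\<^sup>\<star> * component h x) = 0" if "g \<in> M" "h \<in> M" "g \<noteq> h" for g h
  proof (rule E_homogeneous)
    show "homogeneous (inv g \<otimes> h) ((component g x)\<^sup>\<star> * component h x)"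
      using that fin by (intro homogeneous_mult homogeneous_adj component_homogeneous) auto
    show "inv g \<otimes> h \<noteq> \<one>" using that fin by (metis inv_equality inv_inv subsetD inv_closed)
  qed (use that fin in auto)
  have "x\<^sup>\<star> * x = (\<Sum>g\<in>M. (component g x)\<^sup>\<star>) * (\<Sum>h\<in>M. component h x)"
    using supportedD(3)[OF x] by (metis adj_sum)
  hence "E (x\<^sup>\<star> * x) = (\<Sum>g\<in>M. \<Sum>h\<in>M. E ((component g x)\<^sup>\<star> * component h x))"
    by (simp add: sum_product)
  also have "\<dots> = (\<Sum>g\<in>M. \<Sum>h\<in>M. if h = g then E ((component g x)\<^sup>\<star> * component g x) else 0)"
    using orth by (intro sum.cong refl) auto
  finally show ?thesis using fin by simp
qed

lemma E_mono: "x \<preceq> y \<Longrightarrow> E x \<preceq> E y"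
  unfolding cle_def using E_positive[of "y - x"] by simp

lemma E_mult_cle:
  assumes "norm x \<le> c"
  shows "E ((x * z)\<^sup>\<star> * (x * z)) \<preceq> c\<^sup>2 *\<^sub>R E (z\<^sup>\<star> * z)"
proof -
  have "positive (c\<^sup>2 *\<^sub>R 1 - x\<^sup>\<star> * x)"
    using assms by (intro positive_norm_diff) (simp_all add: adj_simps cstar_identity power_mono)
  hence "positive (z\<^sup>\<star> * (c\<^sup>2 *\<^sub>R 1 - x\<^sup>\<star> * x) * z)" by (rule positive_conj)
  hence "(x * z)\<^sup>\<star> * (x * z) \<preceq> c\<^sup>2 *\<^sub>R (z\<^sup>\<star> * z)"
    by (simp add: cle_def adj_mult left_diff_distrib right_diff_distrib mult.assoc)
  from E_mono[OF this] show ?thesis by simp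
qed

text \<open>Splitting \<open>x\<^sub>j y\<close> over \<open>T\<^sub>j\<close> and its complement, largeness makes the second part depend on the
  restriction of \<open>y\<close> to \<open>T\<^sub>j\<close> only; both parts then almost add orthogonally in \<open>j\<close>.\<close>

lemma norm_sum_large_le:
  assumes I: "finite I"
    and x: "\<And>j. j \<in> I \<Longrightarrow> supported (M j) (x j)" "\<And>j. j \<in> I \<Longrightarrow> norm (x j) \<le> c"
    and large: "\<And>j. j \<in> I \<Longrightarrow> large_for G (M j) (T j)"
    and overlap: "\<And>g. g \<in> carrier G \<Longrightarrow> card {j\<in>I. g \<in> T j} \<le> n"
  shows "(norm (sum x I))\<^sup>2 \<le> 4 * real n * real (card I) * c\<^sup>2"
proof -
  define Q where "Q z = E (z\<^sup>\<star> * z)" for z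
  have Qpos: "positive (Q z)" for z unfolding Q_def by (intro E_positive positive_adj_mult)
  \<comment> \<open>Cauchy-Schwarz, with the right side enlarged to all of \<open>I\<close> so that
    it no longer depends on which indices contribute.\<close>
  have Qsum: "Q (sum f K) \<preceq> real k *\<^sub>R (\<Sum>j\<in>I. Q (f j))" if K: "K \<subseteq> I" "card K \<le> k" for f K k
  proof -
    have "Q (sum f K) \<preceq> real (card K) *\<^sub>R (\<Sum>j\<in>K. Q (f j))"
      unfolding Q_def using E_mono[OF adj_mult_sum_cle[of f K]] by simp
    also have "\<dots> \<preceq> real k *\<^sub>R (\<Sum>j\<in>K. Q (f j))"
      using K by (intro scaleR_cle positive_sum Qpos) simp
    also have "\<dots> \<preceq> real k *\<^sub>R (\<Sum>j\<in>I. Q (f j))"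
      using K I by (intro cle_scaleR cle_sum_subset Qpos) simp_all
    finally show ?thesis .
  qed
  let ?X = "sum x I"
  let ?s = "4 * real n * real (card I) * c\<^sup>2"
  have main: "Q (?X * y) \<preceq> ?s *\<^sub>R Q y" if y: "supported S y" for S y
  proof -
    note S = supportedD(1,2)[OF y]
    \<comment> \<open>One finite set that contains the supports of all products, so that every
      expansion has the same index set.\<close>
    define S' where "S' = S \<union> (\<Union>j\<in>I. M j <#> S)"
    have S': "finite S'" "S' \<subseteq> carrier G"
      using S I supportedD(1,2)[OF x(1)]
      by (auto simp: S'_def finite_set_mult dest: subsetD[OF set_mult_carrier])
    define u where "u j = x j * y" for j
    \<comment> \<open>\<open>r j\<close> is the restriction of \<open>y\<close> to
      \<open>T j\<close>.\<close>
    define r where "r j = (\<Sum>g\<in>S \<inter> T j. component g y)" for j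
    define v where "v j = x j * r j" for j
    have r': "supported (S \<inter> T j) (r j)" for j
      unfolding r_def using S by (intro supported_sum_homogeneous component_homogeneous) auto
    have r: "supported S (r j)" for j using S by (intro supported_mono[OF r']) auto
    have su: "supported S' (u j)" "supported S' (v j)" if "j \<in> I" for j
      unfolding u_def v_def using that S'
      by (auto intro!: supported_mono[OF supported_mult[OF x(1) y]]
          supported_mono[OF supported_mult[OF x(1) r]] simp: S'_def)
    \<comment> \<open>The rest \<open>y - r j\<close> lives off \<open>T j\<close>, and largeness
      makes \<open>x j\<close> carry it into \<open>T j\<close>; so it is invisible outside
      \<open>T j\<close>.\<close>
    have uv: "component g (u j) = component g (v j)" if j: "j \<in> I" and g: "g \<in> S'" "g \<notin> T j" for g j
    proof -
      have "y - r j = (\<Sum>g\<in>S - T j. component g y)"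
        using supportedD(3)[OF y] sum.Int_Diff[of S "\<lambda>g. component g y" "T j"] S
        by (simp add: r_def algebra_simps)
      hence yr: "supported (S - T j) (y - r j)"
        using S by (auto intro!: supported_sum_homogeneous component_homogeneous)
      have sup: "supported (M j <#> (S - T j)) (u j - v j)"
        using supported_mult[OF x(1)[OF j] yr] by (simp add: u_def v_def right_diff_distrib)
      have "M j <#> (S - T j) \<subseteq> T j"
        using large[OF j] S unfolding large_for_def by (fastforce simp: set_mult_def l_coset_def)
      hence "component g (u j - v j) = 0"
        using g S' by (intro component_outside[OF sup]) auto
      thus ?thesis by (simp add: component_diff)
    qed
    \<comment> \<open>At each \<open>g\<close> the sum \<open>A g\<close> has at most
      \<open>n\<close> terms. \<open>B g\<close> may have as many as \<open>card I\<close>, but its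
      terms come from the restrictions \<open>r j\<close>, whose square norms add up to at most
      \<open>n\<close> times that of \<open>y\<close>. Either way the product
      \<open>n * card I\<close> appears.\<close>
    define A where "A g = (\<Sum>j\<in>{j\<in>I. g \<in> T j}. component g (u j))" for g
    define B where "B g = (\<Sum>j\<in>{j\<in>I. g \<notin> T j}. component g (v j))" for g
    have comp: "component g (?X * y) = A g + B g" if "g \<in> S'" for g
    proof -
      have "component g (?X * y) = (\<Sum>j\<in>I. component g (u j))"
        by (simp add: sum_distrib_right component_sum u_def)
      also have "\<dots> = A g + (\<Sum>j\<in>{j\<in>I. g \<notin> T j}. component g (u j))"
        unfolding A_def using I by (subst sum.union_disjoint[symmetric]) (auto intro!: sum.cong)
      also have "(\<Sum>j\<in>{j\<in>I. g \<notin> T j}. component g (u j)) = B g"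
        unfolding B_def using that uv by (intro sum.cong) auto
      finally show ?thesis .
    qed
    have "supported S' (?X * y)"
      unfolding sum_distrib_right using su(1) S' by (intro supported_sum) (auto simp: u_def)
    hence "Q (?X * y) = (\<Sum>g\<in>S'. Q (A g + B g))"
      using comp by (simp add: Q_def E_adj_mult_supported)
    also have "\<dots> \<preceq> (\<Sum>g\<in>S'. 2 *\<^sub>R Q (A g) + 2 *\<^sub>R Q (B g))"
      using E_mono[OF adj_mult_add_cle] by (intro cle_sum) (simp add: Q_def)
    also have "\<dots> \<preceq> (\<Sum>g\<in>S'. 2 *\<^sub>R (real n *\<^sub>R (\<Sum>j\<in>I. Q (component g (u j))))
        + 2 *\<^sub>R (real (card I) *\<^sub>R (\<Sum>j\<in>I. Q (component g (v j)))))"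
      unfolding A_def B_def using S' overlap I
      by (intro cle_sum cle_add cle_scaleR Qsum card_mono) auto
    also have "\<dots> = 2 *\<^sub>R (real n *\<^sub>R (\<Sum>j\<in>I. \<Sum>g\<in>S'. Q (component g (u j))))
        + 2 *\<^sub>R (real (card I) *\<^sub>R (\<Sum>j\<in>I. \<Sum>g\<in>S'. Q (component g (v j))))"
      by (simp only: sum.distrib scaleR_sum_right[symmetric] sum.swap[of _ I S'])
    also have "\<dots> = 2 *\<^sub>R (real n *\<^sub>R (\<Sum>j\<in>I. Q (u j))) + 2 *\<^sub>R (real (card I) *\<^sub>R (\<Sum>j\<in>I. Q (v j)))"
      by (simp add: Q_def E_adj_mult_supported[OF su(1)] E_adj_mult_supported[OF su(2)])
    also have "\<dots> \<preceq> 2 *\<^sub>R (real n *\<^sub>R (\<Sum>j\<in>I. c\<^sup>2 *\<^sub>R Q y))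
        + 2 *\<^sub>R (real (card I) *\<^sub>R (\<Sum>j\<in>I. c\<^sup>2 *\<^sub>R Q (r j)))"
      unfolding Q_def u_def v_def by (intro cle_add cle_scaleR cle_sum E_mult_cle x) auto
    also have "\<dots> \<preceq> 2 *\<^sub>R (real n *\<^sub>R (\<Sum>j\<in>I. c\<^sup>2 *\<^sub>R Q y))
        + 2 *\<^sub>R (real (card I) *\<^sub>R c\<^sup>2 *\<^sub>R (real n *\<^sub>R Q y))"
    proof -
      have Qr: "Q (r j) = (\<Sum>g\<in>S. if g \<in> T j then Q (component g y) else 0)" for j
      proof -
        have "component g (r j) = component g y" if "g \<in> S \<inter> T j" for g
          unfolding r_def using that S
          by (subst component_sum_homogeneous) (auto intro: component_homogeneous)
        hence "Q (r j) = (\<Sum>g\<in>S \<inter> T j. Q (component g y))"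
          using E_adj_mult_supported[OF r'] by (simp add: Q_def)
        thus ?thesis using S by (simp add: sum.inter_restrict)
      qed
      \<comment> \<open>Interchanging the sums counts each point of \<open>S\<close> once for every
        \<open>T j\<close> containing it, hence at most \<open>n\<close> times.\<close>
      have "(\<Sum>j\<in>I. Q (r j)) = (\<Sum>g\<in>S. \<Sum>j\<in>I. if g \<in> T j then Q (component g y) else 0)"
        unfolding Qr by (rule sum.swap)
      also have "\<dots> = (\<Sum>g\<in>S. real (card {j\<in>I. g \<in> T j}) *\<^sub>R Q (component g y))"
        using I by (simp add: sum.inter_filter[symmetric] sum_constant_scaleR del: sum_constant)
      also have "\<dots> \<preceq> (\<Sum>g\<in>S. real n *\<^sub>R Q (component g y))"
        using overlap S by (intro cle_sum scaleR_cle Qpos) (auto simp: subset_iff)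
      also have "\<dots> = real n *\<^sub>R Q y"
        using E_adj_mult_supported[OF y] by (simp add: Q_def scaleR_sum_right)
      finally have "(\<Sum>j\<in>I. Q (r j)) \<preceq> real n *\<^sub>R Q y" .
      hence "c\<^sup>2 *\<^sub>R (\<Sum>j\<in>I. Q (r j)) \<preceq> c\<^sup>2 *\<^sub>R (real n *\<^sub>R Q y)" by (rule cle_scaleR) simp
      hence r_le: "(\<Sum>j\<in>I. c\<^sup>2 *\<^sub>R Q (r j)) \<preceq> c\<^sup>2 *\<^sub>R (real n *\<^sub>R Q y)" by (simp only: scaleR_sum_right)
      show ?thesis by (intro cle_add cle_scaleR r_le cle_refl) simp_all
    qed
    also have "\<dots> = ?s *\<^sub>R Q y"
      by (simp add: sum_constant_scaleR scaleR_add_left[symmetric] mult_ac del: sum_constant)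
    finally show ?thesis .
  qed
  \<comment> \<open>Both sides depend continuously on \<open>y\<close> and the positive cone is
    closed, so density extends the estimate.\<close>
  have all: "E ((?X * y)\<^sup>\<star> * (?X * y)) \<preceq> ?s *\<^sub>R E (y\<^sup>\<star> * y)" for y
  proof (rule closed_supportedI[where P = "\<lambda>y. E ((?X * y)\<^sup>\<star> * (?X * y)) \<preceq> ?s *\<^sub>R E (y\<^sup>\<star> * y)"])
    have "closed ((\<lambda>y. ?s *\<^sub>R E (y\<^sup>\<star> * y) - E ((?X * y)\<^sup>\<star> * (?X * y))) -` {a. positive a})"
      by (intro closed_vimage closed_positive continuous_intros
          bounded_linear.continuous_on[OF bounded_linear_E]
          bounded_linear.continuous_on[OF bounded_linear_adj])
    thus "closed {y. E ((?X * y)\<^sup>\<star> * (?X * y)) \<preceq> ?s *\<^sub>R E (y\<^sup>\<star> * y)}"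
      by (simp add: vimage_def cle_def)
    show "E ((?X * y)\<^sup>\<star> * (?X * y)) \<preceq> ?s *\<^sub>R E (y\<^sup>\<star> * y)" if "supported M y" for M y
      using main[OF that] by (simp add: Q_def)
  qed
  show ?thesis
    by (rule norm_le_of_faithful[OF clinear_E E_positive faithful all]) simp_all
qed

section \<open>Averaging\<close>

definition average :: "nat \<Rightarrow> (nat \<Rightarrow> 'g) \<Rightarrow> 'b \<Rightarrow> 'b" where
  "average N h x = (1 / real N) *\<^sub>R (\<Sum>j\<in>{1..N}. l (h j) * x * (l (h j))\<^sup>\<star>)"

text \<open>The set records the products of the group elements used in an iterated average, that is, the
  conjugates that can occur in the support of its values.\<close>

inductive iterated_average :: "'g set \<Rightarrow> ('b \<Rightarrow> 'b) \<Rightarrow> bool" where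
  iterated_average_id: "iterated_average {\<one>} (\<lambda>x. x)"
| iterated_average_step: "iterated_average M \<Phi> \<Longrightarrow> 1 \<le> N \<Longrightarrow> h ` {1..N} \<subseteq> carrier G \<Longrightarrow>
    iterated_average (h ` {1..N} <#> M) (\<lambda>x. average N h (\<Phi> x))"

lemma clinear_average: "clinear (average N h)"
  by (simp add: clinear_def average_def distrib_left distrib_right sum.distrib scaleR_add_right
      mult_scaleC_left mult_scaleC_right clinear_sum[of "(*\<^sub>C) _", symmetric] scaleC_add_right
      scaleR_scaleC scaleC_scaleC mult.commute)

lemma norm_average_le:
  assumes "1 \<le> N" "h ` {1..N} \<subseteq> carrier G"
  shows "norm (average N h x) \<le> norm x"
proof -
  have "norm (\<Sum>j\<in>{1..N}. l (h j) * x * (l (h j))\<^sup>\<star>) \<le> (\<Sum>j\<in>{1..N}. norm x)"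
  proof (rule sum_norm_le)
    fix j assume "j \<in> {1..N}"
    hence h: "h j \<in> carrier G" using assms by blast
    have "norm (l (h j) * x * (l (h j))\<^sup>\<star>) \<le> norm (l (h j)) * norm x * norm ((l (h j))\<^sup>\<star>)"
      by (intro order_trans[OF norm_mult_ineq] mult_right_mono norm_mult_ineq) simp
    thus "norm (l (h j) * x * (l (h j))\<^sup>\<star>) \<le> norm x" using h by simp
  qed
  thus ?thesis using assms by (simp add: average_def divide_simps mult.commute)
qed

lemma iterated_average_linear:
  assumes "iterated_average M \<Phi>"
  shows "\<Phi> (x + y) = \<Phi> x + \<Phi> y" "\<Phi> (c *\<^sub>C x) = c *\<^sub>C \<Phi> x"
  using assms by (induction) (simp_all add: clinear_simps[OF clinear_average])

lemma clinear_iterated_average: "iterated_average M \<Phi> \<Longrightarrow> clinear \<Phi>"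
  by (simp add: clinear_def iterated_average_linear)

lemma norm_iterated_average_le: "iterated_average M \<Phi> \<Longrightarrow> norm (\<Phi> x) \<le> norm x"
proof (induction rule: iterated_average.induct)
  case (iterated_average_step M \<Phi> N h)
  show ?case
    using norm_average_le[OF iterated_average_step.hyps(2,3)] iterated_average_step.IH
    by (rule order_trans)
qed simp

lemma iterated_average_one: "iterated_average M \<Phi> \<Longrightarrow> \<Phi> 1 = 1"
proof (induction rule: iterated_average.induct)
  case (iterated_average_step M \<Phi> N h)
  have "(\<Sum>j\<in>{1..N}. l (h j) * 1 * (l (h j))\<^sup>\<star>) = (\<Sum>j\<in>{1..N}. 1)"
    using iterated_average_step by (intro sum.cong) (auto simp: image_subset_iff)
  also have "\<dots> = real N *\<^sub>R 1" by (simp add: sum_constant_scaleR del: sum_constant)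
  finally show ?case using iterated_average_step by (simp add: average_def)
qed simp

lemma iterated_average_carrier:
  "iterated_average M \<Phi> \<Longrightarrow> finite M \<and> M \<noteq> {} \<and> M \<subseteq> carrier G"
  by (induction rule: iterated_average.induct)
     (auto simp: finite_set_mult dest: subsetD[OF set_mult_carrier] simp: set_mult_def)

lemma iterated_average_ideal:
  assumes "iterated_average M \<Phi>" and J: "cstar_ideal J" and x: "x \<in> J"
  shows "\<Phi> x \<in> J"
  using assms(1)
proof (induction rule: iterated_average.induct)
  case (iterated_average_step M \<Phi> N h)
  have "(\<Sum>j\<in>K. l (h j) * \<Phi> x * (l (h j))\<^sup>\<star>) \<in> J" for K
    using J iterated_average_step.IH unfolding cstar_ideal_def
    by (induction K rule: infinite_finite_induct) auto
  thus ?case using J unfolding average_def cstar_ideal_def scaleR_scaleC by blast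
qed (rule x)

lemma iterated_average_trace:
  assumes "iterated_average M \<Phi>" and \<tau>: "tracial_state \<tau>"
  shows "\<tau> (\<Phi> x) = \<tau> x"
  using assms(1)
proof (induction rule: iterated_average.induct)
  case (iterated_average_step M \<Phi> N h)
  have lin: "clinear \<tau>" using \<tau> by (simp add: tracial_state_def state_def)
  have "\<tau> (l (h j) * \<Phi> x * (l (h j))\<^sup>\<star>) = \<tau> x" if "j \<in> {1..N}" for j
  proof -
    have "h j \<in> carrier G" using that iterated_average_step by blast
    moreover have "\<tau> (l (h j) * \<Phi> x * (l (h j))\<^sup>\<star>) = \<tau> ((l (h j))\<^sup>\<star> * (l (h j) * \<Phi> x))"
      using \<tau> by (simp add: tracial_state_def)
    ultimately show ?thesis using iterated_average_step by simp
  qed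
  hence "\<tau> (average N h (\<Phi> x)) = (1 / real N) *\<^sub>R (\<Sum>j\<in>{1..N}. \<tau> x)"
    unfolding average_def clinear_scaleR[OF lin] clinear_sum[OF lin] by simp
  thus ?case using iterated_average_step.hyps by (simp add: scaleR_conv_of_real)
qed simp

lemma supported_conj:
  assumes x: "supported F x" and h: "h \<in> carrier G"
  shows "supported (conj_set G h F) (l h * x * (l h)\<^sup>\<star>)"
proof -
  note F = supportedD(1,2)[OF x]
  have "l h * x * (l h)\<^sup>\<star> = (\<Sum>g\<in>F. l h * component g x * (l h)\<^sup>\<star>)"
    using supportedD(3)[OF x] by (metis sum_distrib_left sum_distrib_right)
  moreover have "supported (conj_set G h F) (l h * component g x * (l h)\<^sup>\<star>)" if "g \<in> F" for g
  proof (rule supported_mono)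
    show "supported {h \<otimes> g \<otimes> inv h} (l h * component g x * (l h)\<^sup>\<star>)"
      using that F h by (intro supported_homogeneous homogeneous_conj component_homogeneous) auto
  qed (use that F h in \<open>auto simp: conj_set_def\<close>)
  ultimately show ?thesis
    using F h by (auto simp: conj_set_def intro!: supported_sum)
qed

text \<open>Starting from one group element, averaging produces only its conjugates by members of
  \<open>M\<close>. These are the sets for which \<open>c_powers_set\<close> provides
  conjugators.\<close>

lemma iterated_average_supported:
  assumes "iterated_average M \<Phi>" and x: "supported {g} x"
  shows "supported (conj_orbit G M g) (\<Phi> x)"
  using assms(1)
proof (induction rule: iterated_average.induct)
  case iterated_average_id
  have "conj_orbit G {\<one>} g = {g}" using supportedD(2)[OF x] by (auto simp: conj_orbit_def)
  thus ?case using x by simp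
next
  case (iterated_average_step M \<Phi> N h)
  note M = iterated_average_carrier[OF iterated_average_step.hyps(1)]
  have g: "g \<in> carrier G" using supportedD(2)[OF x] by simp
  let ?M = "h ` {1..N} <#> M"
  have hM: "?M \<subseteq> carrier G" using M iterated_average_step.hyps by (intro set_mult_carrier) auto
  have fin: "finite (conj_orbit G ?M g)" "conj_orbit G ?M g \<subseteq> carrier G"
    using M g hM by (auto simp: conj_orbit_def Setcompr_eq_image finite_set_mult)
  have "supported (conj_orbit G ?M g) (l (h j) * \<Phi> x * (l (h j))\<^sup>\<star>)" if j: "j \<in> {1..N}" for j
  proof (rule supported_mono[OF supported_conj[OF iterated_average_step.IH] _ fin])
    show hj: "h j \<in> carrier G" using j iterated_average_step.hyps by blast
    show "conj_set G (h j) (conj_orbit G M g) \<subseteq> conj_orbit G ?M g"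
    proof
      fix y assume "y \<in> conj_set G (h j) (conj_orbit G M g)"
      then obtain s where s: "s \<in> M" "y = h j \<otimes> (s \<otimes> g \<otimes> inv s) \<otimes> inv h j"
        by (auto simp: conj_set_def conj_orbit_def)
      hence "y = (h j \<otimes> s) \<otimes> g \<otimes> inv (h j \<otimes> s)"
        using hj g M by (auto simp: inv_mult_group m_assoc subset_iff)
      moreover have "h j \<otimes> s \<in> ?M" using j s by (auto simp: set_mult_def)
      ultimately show "y \<in> conj_orbit G ?M g" by (auto simp: conj_orbit_def)
    qed
  qed
  thus ?case
    unfolding average_def scaleR_scaleC using fin by (intro supported_scaleC supported_sum)
qed

text \<open>The sum of \<open>N\<close> conjugates has norm of order \<open>sqrt N\<close> while the
  overlap bound \<open>n\<close> stays fixed, so the average decays like \<open>1 / sqrt N\<close>.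
  The set \<open>H\<close> is kept because the chain argument must choose conjugators inside a given
  subgroup.\<close>

lemma average_small:
  assumes z: "supported F z" and \<epsilon>: "0 < \<epsilon>" and H: "H \<subseteq> carrier G"
    and large: "\<And>N::nat. 1 \<le> N \<Longrightarrow> \<exists>h T. (\<forall>j\<in>{1..N}. h j \<in> H \<and> large_for G (conj_set G (h j) F) (T j)) \<and>
        (\<forall>g\<in>carrier G. card {j\<in>{1..N}. g \<in> T j} \<le> n)"
  obtains N h where "1 \<le> N" "h ` {1..N} \<subseteq> H" "norm (average N h z) < \<epsilon>"
proof -
  obtain N0 :: nat where N0: "4 * real n * (norm z)\<^sup>2 / \<epsilon>\<^sup>2 < real N0" using reals_Archimedean2 by blast
  define N where "N = Suc N0"
  have N: "1 \<le> N" "4 * real n * (norm z)\<^sup>2 / \<epsilon>\<^sup>2 < real N" using N0 by (simp_all add: N_def)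
  obtain h T where hT: "\<And>j. j \<in> {1..N} \<Longrightarrow> h j \<in> H"
      "\<And>j. j \<in> {1..N} \<Longrightarrow> large_for G (conj_set G (h j) F) (T j)"
      "\<And>g. g \<in> carrier G \<Longrightarrow> card {j\<in>{1..N}. g \<in> T j} \<le> n"
    using large[OF N(1)] by blast
  let ?X = "\<Sum>j\<in>{1..N}. l (h j) * z * (l (h j))\<^sup>\<star>"
  have "norm (l (h j) * z * (l (h j))\<^sup>\<star>) \<le> norm z" if "j \<in> {1..N}" for j
    using norm_average_le[of 1 "\<lambda>_. h j" z] hT(1)[OF that] H by (auto simp: average_def)
  hence "(norm ?X)\<^sup>2 \<le> 4 * real n * real (card {1..N}) * (norm z)\<^sup>2"
    using hT H by (intro norm_sum_large_le[where M = "\<lambda>j. conj_set G (h j) F" and T = T])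
      (auto intro!: supported_conj[OF z])
  hence "(norm ?X)\<^sup>2 / (real N)\<^sup>2 \<le> 4 * real n * real N * (norm z)\<^sup>2 / (real N)\<^sup>2"
    by (intro divide_right_mono) simp_all
  also have "\<dots> = 4 * real n * (norm z)\<^sup>2 / real N" using N by (simp add: power2_eq_square)
  also have "\<dots> < \<epsilon>\<^sup>2" using N \<epsilon> by (simp add: field_simps)
  finally have "(norm (average N h z))\<^sup>2 < \<epsilon>\<^sup>2" by (simp add: average_def power_divide)
  hence "norm (average N h z) < \<epsilon>" using \<epsilon> by (simp add: power2_less_imp_less)
  thus ?thesis using that N hT(1) by blast
qed

section \<open>Small averages for the two kinds of groups\<close>

lemma PH_iterated_average_small:
  assumes PH: "PH_group G" and z: "supported F z" and F: "\<one> \<notin> F" "F \<noteq> {}" and \<epsilon>: "0 < \<epsilon>"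
  shows "\<exists>M \<Phi>. iterated_average M \<Phi> \<and> norm (\<Phi> z) < \<epsilon>"
proof -
  obtain n f K where f: "bij_betw f {1..n::nat} F"
      and K: "\<And>j. j \<in> {1..n} \<Longrightarrow> subgroup (K j) G"
        "\<And>i j. i \<in> {1..n} \<Longrightarrow> j \<in> {1..n} \<Longrightarrow> i \<le> j \<Longrightarrow> K i \<subseteq> K j"
        "\<And>j. j \<in> {1..n} \<Longrightarrow> c_powers_set G (f j) (K j)"
  proof -
    have "finite F \<and> F \<noteq> {} \<and> F \<subseteq> carrier G - {\<one>}" using supportedD[OF z] F by auto
    from PH[unfolded PH_group_def, THEN conjunct2, rule_format, OF this] that show ?thesis
      by (elim exE conjE) blast
  qed
  define a where "a i = component (f i) z" for i
  \<comment> \<open>Dividing by \<open>Suc n\<close> keeps the sum of \<open>n\<close> errors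
    strictly below \<open>\<epsilon>\<close>.\<close>
  define \<delta> where "\<delta> = \<epsilon> / real (Suc n)"
  have \<delta>: "0 < \<delta>" using \<epsilon> by (simp add: \<delta>_def)
  have fc: "f i \<in> carrier G" if "i \<in> {1..n}" for i
    using that bij_betwE[OF f] supportedD(2)[OF z] by blast
  \<comment> \<open>The conjugators used so far lie in every subgroup still to come, so the next
    element has a Powers set for its orbit under \<open>M\<close>. Components already made small
    stay small because averages are contractive.\<close>
  have "\<exists>M \<Phi>. iterated_average M \<Phi> \<and> (\<forall>i\<in>{1..n}. k \<le> i \<longrightarrow> M \<subseteq> K i) \<and>
      (\<forall>i\<in>{1..k}. norm (\<Phi> (a i)) < \<delta>)"
    if "k \<le> n" for k
    using that
  proof (induction k)
    case 0
    have "\<forall>i\<in>{1..n}. {\<one>} \<subseteq> K i" using K(1) by (simp add: subgroup.one_closed)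
    thus ?case using iterated_average_id by auto
  next
    case (Suc k)
    then obtain M \<Phi> where M: "iterated_average M \<Phi>" "\<forall>i\<in>{1..n}. k \<le> i \<longrightarrow> M \<subseteq> K i"
        "\<forall>i\<in>{1..k}. norm (\<Phi> (a i)) < \<delta>" by auto
    define L where "L = K (Suc k)"
    have subL: "subgroup L G" unfolding L_def using Suc.prems by (intro K(1)) simp
    have LM: "M \<subseteq> L" using M(2) Suc.prems by (simp add: L_def)
    have sup: "supported (conj_orbit G M (f (Suc k))) (\<Phi> (a (Suc k)))"
      unfolding a_def using Suc.prems
      by (intro iterated_average_supported[OF M(1)] supported_homogeneous component_homogeneous fc) simp
    have pow: "powers_set G (conj_orbit G M (f (Suc k))) L"
      using K(3)[of "Suc k"] iterated_average_carrier[OF M(1)] LM Suc.prems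
      by (simp add: c_powers_set_def L_def)
    obtain N h where N: "1 \<le> N" "h ` {1..N} \<subseteq> L" "norm (average N h (\<Phi> (a (Suc k)))) < \<delta>"
    proof (rule average_small[OF sup \<delta> subgroup.subset[OF subL], where n = 1])
      fix N :: nat assume "1 \<le> N"
      then obtain h T where hT: "\<forall>j\<in>{1..N}. h j \<in> L \<and> T j \<subseteq> carrier G" "disjoint_family_on T {1..N}"
          "\<forall>j\<in>{1..N}. large_for G (conj_set G (h j) (conj_orbit G M (f (Suc k)))) (T j)"
        using pow unfolding powers_set_def by blast
      \<comment> \<open>Disjointness is overlap at most 1.\<close>
      have "card {j\<in>{1..N}. g \<in> T j} \<le> 1" for g
      proof -
        have "\<forall>i\<in>{j\<in>{1..N}. g \<in> T j}. \<forall>k\<in>{j\<in>{1..N}. g \<in> T j}. i = k"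
          using hT(2) unfolding disjoint_family_on_def by blast
        thus ?thesis using card_le_Suc0_iff_eq[of "{j\<in>{1..N}. g \<in> T j}"] by simp
      qed
      thus "\<exists>h T. (\<forall>j\<in>{1..N}. h j \<in> L \<and> large_for G (conj_set G (h j) (conj_orbit G M (f (Suc k)))) (T j)) \<and>
          (\<forall>g\<in>carrier G. card {j\<in>{1..N}. g \<in> T j} \<le> 1)"
        using hT by blast
    qed blast
    have hG: "h ` {1..N} \<subseteq> carrier G" using N(2) subgroup.subset[OF subL] by blast
    let ?\<Psi> = "\<lambda>x. average N h (\<Phi> x)"
    have "iterated_average (h ` {1..N} <#> M) ?\<Psi>" using M(1) N(1) hG by (rule iterated_average_step)
    moreover have "h ` {1..N} <#> M \<subseteq> L"
      using N(2) LM subgroup.m_closed[OF subL] by (auto simp: set_mult_def image_subset_iff)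
    hence "\<forall>i\<in>{1..n}. Suc k \<le> i \<longrightarrow> h ` {1..N} <#> M \<subseteq> K i"
      using K(2)[of "Suc k"] Suc.prems unfolding L_def by fastforce
    moreover have "norm (?\<Psi> (a i)) < \<delta>" if "i \<in> {1..Suc k}" for i
    proof (cases "i = Suc k")
      case False
      hence "norm (\<Phi> (a i)) < \<delta>" using that M(3) by auto
      with norm_average_le[OF N(1) hG] show ?thesis by (rule order_le_less_trans)
    qed (use N(3) in simp)
    ultimately show ?case by blast
  qed
  from this[OF order_refl] obtain M \<Phi> where M: "iterated_average M \<Phi>"
      and small: "\<And>i. i \<in> {1..n} \<Longrightarrow> norm (\<Phi> (a i)) < \<delta>" by blast
  have "z = (\<Sum>i\<in>{1..n}. a i)"
    using sum.reindex_bij_betw[OF f, of "\<lambda>g. component g z"] supportedD(3)[OF z] by (simp add: a_def)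
  hence "\<Phi> z = (\<Sum>i\<in>{1..n}. \<Phi> (a i))"
    by (simp add: clinear_sum[OF clinear_iterated_average[OF M]])
  also have "norm \<dots> \<le> (\<Sum>i\<in>{1..n}. \<delta>)"
    using small by (intro sum_norm_le) (simp add: less_imp_le)
  also have "\<dots> < \<epsilon>" using \<epsilon> by (simp add: \<delta>_def field_simps)
  finally have "norm (\<Phi> z) < \<epsilon>" .
  thus ?thesis using M by blast
qed

lemma P_com_iterated_average_small:
  assumes P: "P_com_group G" and z: "supported F z" and F: "\<one> \<notin> F" "F \<noteq> {}" and \<epsilon>: "0 < \<epsilon>"
  shows "\<exists>M \<Phi>. iterated_average M \<Phi> \<and> norm (\<Phi> z) < \<epsilon>"
proof -
  have FG: "finite F" "F \<subseteq> carrier G" using supportedD[OF z] by auto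
  obtain n :: nat and g\<^sub>0 U and D :: "nat \<Rightarrow> 'g set" where g0: "g\<^sub>0 \<in> carrier G" and U: "U \<subseteq> carrier G"
      and cover: "carrier G - U \<subseteq> (\<Union>k\<in>{1..n}. D k)"
      and FU: "\<And>g. g \<in> F \<Longrightarrow> (g <# U) \<inter> U = {}"
      and DD: "\<And>j k. k \<in> {1..n} \<Longrightarrow> 1 \<le> (j::nat) \<Longrightarrow> ((g\<^sub>0 [^] (- int j)) <# D k) \<inter> D k = {}"
  proof -
    have "finite F \<and> F \<noteq> {} \<and> F \<subseteq> carrier G - {\<one>}" using FG F by auto
    from P[unfolded P_com_group_def, THEN conjunct2, rule_format, OF this] that show ?thesis
      by (elim exE conjE) (metis (no_types))
  qed
  define h where "h j = g\<^sub>0 [^] int j" for j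
  define T where "T j = h j <# (carrier G - U)" for j
  have h: "h j \<in> carrier G" for j using g0 by (simp add: h_def)
  have T: "g \<in> T j \<longleftrightarrow> inv (h j) \<otimes> g \<notin> U" if g: "g \<in> carrier G" for g j
  proof
    assume "g \<in> T j"
    thus "inv (h j) \<otimes> g \<notin> U" using h[of j] by (auto simp: T_def l_coset_def m_assoc[symmetric])
  next
    assume "inv (h j) \<otimes> g \<notin> U"
    moreover have "g = h j \<otimes> (inv (h j) \<otimes> g)" using g h[of j] by (simp add: m_assoc[symmetric])
    ultimately show "g \<in> T j" using g h[of j] unfolding T_def l_coset_def by blast
  qed
  \<comment> \<open>A point outside \<open>T j\<close> is moved into \<open>U\<close> by
    \<open>inv (h j)\<close>; then \<open>f\<close> pushes it out of \<open>U\<close>, and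
    \<open>h j\<close> returns it to \<open>T j\<close>.\<close>
  have large: "large_for G (conj_set G (h j) F) (T j)" for j
    unfolding large_for_def
  proof (intro ballI subsetI)
    fix m y assume "m \<in> conj_set G (h j) F" "y \<in> m <# (carrier G - T j)"
    then obtain f s where f: "f \<in> F" and s: "s \<in> carrier G" "s \<notin> T j"
        and y: "y = (h j \<otimes> f \<otimes> inv (h j)) \<otimes> s"
      by (auto simp: conj_set_def l_coset_def)
    have fG: "f \<in> carrier G" using f FG by blast
    have "inv (h j) \<otimes> s \<in> U" using T s by blast
    hence "f \<otimes> (inv (h j) \<otimes> s) \<in> f <# U" by (auto simp: l_coset_def)
    hence "f \<otimes> (inv (h j) \<otimes> s) \<notin> U" using FU[OF f] by blast
    moreover have "inv (h j) \<otimes> y = f \<otimes> (inv (h j) \<otimes> s)"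
      unfolding y using h[of j] fG s(1) by (simp add: m_assoc[symmetric])
    ultimately show "y \<in> T j" using T[of y j] y h[of j] fG s(1) by simp
  qed
  have overlap: "card {j\<in>{1..N}. g \<in> T j} \<le> n" if g: "g \<in> carrier G" for N g
  proof -
    let ?B = "\<lambda>k. {j\<in>{1..N}. inv (h j) \<otimes> g \<in> D k}"
    \<comment> \<open>Two indices \<open>i < j\<close> in the same \<open>?B k\<close> would make
      \<open>D k\<close> meet its translate by the power \<open>- (j - i)\<close> of the chosen
      element. So each of the \<open>n\<close> sets \<open>D k\<close> accounts for at most one
      index.\<close>
    have uniq: "\<not> i < j" if k: "k \<in> {1..n}" and i: "i \<in> ?B k" and j: "j \<in> ?B k" for i j k
    proof
      assume "i < j"
      have "inv (h j) = g\<^sub>0 [^] (- int (j - i)) \<otimes> inv (h i)"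
        using g0 \<open>i < j\<close> by (simp add: h_def int_pow_neg[symmetric] int_pow_mult[symmetric] of_nat_diff)
      hence "inv (h j) \<otimes> g = g\<^sub>0 [^] (- int (j - i)) \<otimes> (inv (h i) \<otimes> g)"
        using g g0 h[of i] by (simp add: m_assoc)
      hence "inv (h j) \<otimes> g \<in> (g\<^sub>0 [^] (- int (j - i))) <# D k"
        using i by (auto simp: l_coset_def)
      moreover have "inv (h j) \<otimes> g \<in> D k" using j by blast
      moreover have "1 \<le> j - i" using \<open>i < j\<close> by simp
      ultimately show False using DD[OF k] by blast
    qed
    have "{j\<in>{1..N}. g \<in> T j} \<subseteq> (\<Union>k\<in>{1..n}. ?B k)"
    proof
      fix j assume "j \<in> {j\<in>{1..N}. g \<in> T j}"
      hence "j \<in> {1..N}" "inv (h j) \<otimes> g \<in> carrier G - U" using T[OF g] g h[of j] by auto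
      thus "j \<in> (\<Union>k\<in>{1..n}. ?B k)" using cover by blast
    qed
    hence "card {j\<in>{1..N}. g \<in> T j} \<le> card (\<Union>k\<in>{1..n}. ?B k)" by (intro card_mono) auto
    also have "\<dots> \<le> (\<Sum>k\<in>{1..n}. card (?B k))" by (intro card_UN_le) simp
    also have "\<dots> \<le> (\<Sum>k\<in>{1..n}. 1)"
    proof (rule sum_mono)
      fix k assume k: "k \<in> {1..n}"
      have "finite (?B k)" by simp
      moreover have "i = j" if "i \<in> ?B k" "j \<in> ?B k" for i j
        using uniq[OF k that] uniq[OF k that(2,1)] by linarith
      ultimately show "card (?B k) \<le> 1" unfolding One_nat_def by (subst card_le_Suc0_iff_eq) blast+
    qed
    finally show ?thesis by simp
  qed
  obtain N h' where N: "1 \<le> N" "h' ` {1..N} \<subseteq> carrier G" "norm (average N h' z) < \<epsilon>"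
    using average_small[OF z \<epsilon> order_refl, of n] h large overlap by blast
  show ?thesis using iterated_average_step[OF iterated_average_id N(1,2)] N(3) by blast
qed

text \<open>The two families of groups enter only through this averaging property.\<close>

lemma iterated_average_small:
  assumes P: "class_P G" and y: "E y = 0" and \<epsilon>: "0 < \<epsilon>"
  obtains M \<Phi> where "iterated_average M \<Phi>" "norm (\<Phi> y) < \<epsilon>"
proof -
  obtain C where C: "0 < C" "\<And>x. norm (\<iota> (E x)) \<le> norm x * C"
    using bounded_linear.pos_bounded[OF bounded_linear_compose[OF bounded_linear_\<iota> bounded_linear_E]]
    by blast
  \<comment> \<open>As \<open>E y = 0\<close>, removing the expectation from the approximant
    \<open>x\<close> costs at most \<open>C\<close> times the approximation error, which brings
    \<open>z\<close> within \<open>\<epsilon> / 2\<close> of \<open>y\<close>.\<close>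
  define \<delta> where "\<delta> = \<epsilon> / (2 * (1 + C))"
  have \<delta>: "0 < \<delta>" using \<epsilon> C by (simp add: \<delta>_def)
  obtain F x where x: "supported F x" "norm (y - x) < \<delta>" using supported_approx[OF \<delta>] by blast
  define z where "z = x - \<iota> (E x)"
  have z: "supported (F - {\<one>}) z" unfolding z_def by (rule supported_diff_expectation[OF x(1)])
  have "y - z = (y - x) - \<iota> (E (y - x))" by (simp add: z_def y)
  hence "norm (y - z) \<le> norm (y - x) + norm (\<iota> (E (y - x)))" by (metis norm_triangle_ineq4)
  also have "\<dots> \<le> norm (y - x) * (1 + C)" using C(2)[of "y - x"] by (simp add: algebra_simps)
  also have "\<dots> \<le> \<delta> * (1 + C)" using x(2) C(1) by (intro mult_right_mono) simp_all
  also have "\<dots> = \<epsilon> / 2" using C(1) by (simp add: \<delta>_def divide_simps)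
  finally have yz: "norm (y - z) \<le> \<epsilon> / 2" .
  have "\<exists>M \<Phi>. iterated_average M \<Phi> \<and> norm (\<Phi> z) < \<epsilon> / 2"
  \<comment> \<open>The group conditions speak of non-empty sets only; for the empty support
    \<open>z\<close> is 0 and the identity map serves.\<close>
  proof (cases "F - {\<one>} = {}")
    case True
    hence z0: "z = 0" using supportedD(3)[OF z] by (simp only: sum.empty)
    show ?thesis
      by (intro exI conjI, rule iterated_average_id) (use z0 \<epsilon> in simp)
  next
    case False
    show ?thesis
      using P unfolding class_P_def
    proof
      assume "PH_group G"
      thus ?thesis using \<epsilon> by (intro PH_iterated_average_small[OF _ z _ False]) simp_all
    next
      assume "P_com_group G"
      thus ?thesis using \<epsilon> by (intro P_com_iterated_average_small[OF _ z _ False]) simp_all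
    qed
  qed
  then obtain M \<Phi> where M: "iterated_average M \<Phi>" "norm (\<Phi> z) < \<epsilon> / 2" by blast
  have "\<Phi> y = \<Phi> z + \<Phi> (y - z)"
    using clinear_add[OF clinear_iterated_average[OF M(1)], of z "y - z"] by simp
  hence "norm (\<Phi> y) \<le> norm (\<Phi> z) + norm (\<Phi> (y - z))" by (simp add: norm_triangle_ineq)
  also have "\<dots> < \<epsilon>" using M(2) yz norm_iterated_average_le[OF M(1), of "y - z"] by simp
  finally show ?thesis using that M(1) by blast
qed

section \<open>Traces and ideals\<close>

lemma unital_star_hom_\<alpha>: "g \<in> carrier G \<Longrightarrow> unital_star_hom (\<alpha> g)"
  using automorphism by (simp add: star_automorphism_def)

lemma clinear_\<alpha>: "g \<in> carrier G \<Longrightarrow> clinear (\<alpha> g)"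
  using unital_star_hom_\<alpha> by (simp add: unital_star_hom_def)

lemma bounded_linear_\<alpha>: "g \<in> carrier G \<Longrightarrow> bounded_linear (\<alpha> g)"
  by (rule star_hom_bounded_linear[OF unital_star_hom_\<alpha>])

text \<open>On the identity fibre this is covariance. Conjugation maps every other fibre to a fibre
  over a nontrivial element, where both sides vanish; density does the rest.\<close>

lemma E_conj:
  assumes g: "g \<in> carrier G"
  shows "E (l g * y * (l g)\<^sup>\<star>) = \<alpha> g (E y)"
proof (rule closed_supportedI[where P = "\<lambda>y. E (l g * y * (l g)\<^sup>\<star>) = \<alpha> g (E y)"])
  show "closed {y. E (l g * y * (l g)\<^sup>\<star>) = \<alpha> g (E y)}"
    by (intro closed_Collect_eq continuous_intros bounded_linear.continuous_on[OF bounded_linear_E]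
        bounded_linear.continuous_on[OF bounded_linear_\<alpha>] g)
next
  note [simp] = clinear_simps[OF clinear_\<alpha>[OF g]]
  have hom: "E (l g * x * (l g)\<^sup>\<star>) = \<alpha> g (E x)" if x: "homogeneous h x" and h: "h \<in> carrier G" for h x
  proof (cases "h = \<one>")
    case True
    then obtain a where "x = \<iota> a" using x unfolding homogeneous_def by auto
    thus ?thesis using covariance[OF g, of a, symmetric] by simp
  next
    case False
    have "g \<otimes> h \<otimes> inv g \<noteq> \<one>"
    proof
      assume "g \<otimes> h \<otimes> inv g = \<one>"
      hence "g \<otimes> h = g" using g h by (metis inv_equality inv_inv inv_closed m_closed)
      thus False using False g h by (simp add: r_cancel_one)
    qed
    hence "E (l g * x * (l g)\<^sup>\<star>) = 0"
      using g h by (intro E_homogeneous[OF homogeneous_conj[OF x]]) auto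
    thus ?thesis using E_homogeneous[OF x h False] by simp
  qed
  fix M y assume y: "supported M y"
  have "E (l g * y * (l g)\<^sup>\<star>) = (\<Sum>h\<in>M. E (l g * component h y * (l g)\<^sup>\<star>))"
    by (subst supportedD(3)[OF y, symmetric]) (simp add: sum_distrib_left sum_distrib_right)
  also have "\<dots> = (\<Sum>h\<in>M. \<alpha> g (E (component h y)))"
    using supportedD(2)[OF y] by (intro sum.cong refl hom[OF component_homogeneous]) auto
  also have "\<dots> = \<alpha> g (E (\<Sum>h\<in>M. component h y))" by simp
  finally show "E (l g * y * (l g)\<^sup>\<star>) = \<alpha> g (E y)" by (simp add: supportedD(3)[OF y])
qed

section \<open>Traces of the crossed product\<close>

text \<open>Averaging does not change the value of \<open>\<tau>\<close>, yet averages of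
  \<open>x - \<iota> (E x)\<close> become arbitrarily small, and \<open>\<tau>\<close> is
  bounded.\<close>

lemma tracial_state_factors:
  assumes P: "class_P G" and \<tau>: "tracial_state \<tau>"
  shows "\<tau> x = \<tau> (\<iota> (E x))"
proof -
  have st: "state \<tau>" using \<tau> by (simp add: tracial_state_def)
  hence lin: "clinear \<tau>" by (simp add: state_def)
  obtain C where C: "0 < C" "\<And>x. norm (\<tau> x) \<le> norm x * C"
    using bounded_linear.pos_bounded[OF state_bounded_linear[OF st]] by blast
  define y where "y = x - \<iota> (E x)"
  have y: "E y = 0" by (simp add: y_def)
  have "norm (\<tau> y) \<le> \<epsilon>" if \<epsilon>: "0 < \<epsilon>" for \<epsilon>
  proof -
    obtain M \<Phi> where M: "iterated_average M \<Phi>" "norm (\<Phi> y) < \<epsilon> / C"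
      using iterated_average_small[OF P y, of "\<epsilon> / C"] \<epsilon> C(1) by auto
    have "norm (\<tau> y) = norm (\<tau> (\<Phi> y))" by (simp add: iterated_average_trace[OF M(1) \<tau>])
    also have "\<dots> \<le> norm (\<Phi> y) * C" by (rule C(2))
    also have "\<dots> \<le> \<epsilon>" using M(2) C(1) by (simp add: field_simps)
    finally show ?thesis .
  qed
  hence "norm (\<tau> y) \<le> 0" using field_le_epsilon[of "norm (\<tau> y)" 0] by simp
  thus ?thesis by (simp add: y_def clinear_diff[OF lin])
qed

lemma invariant_tracial_state_restriction:
  assumes \<tau>: "tracial_state \<tau>"
  shows "invariant_tracial_state G \<alpha> (\<tau> \<circ> \<iota>)"
proof -
  have st: "state \<tau>" and tr: "\<And>x y. \<tau> (x * y) = \<tau> (y * x)"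
    using \<tau> by (simp_all add: tracial_state_def)
  have "positive (\<iota> a)" if "positive a" for a
    using that unfolding positive_def by (metis \<iota>_adj \<iota>_mult)
  hence "state (\<tau> \<circ> \<iota>)" using st by (simp add: state_def clinear_def)
  moreover have "\<tau> (\<iota> (\<alpha> g a)) = \<tau> (\<iota> a)" if "g \<in> carrier G" for g a
    using that tr[of "l g * \<iota> a" "(l g)\<^sup>\<star>"] by (simp add: covariance)
  ultimately show ?thesis
    using tr by (auto simp: invariant_tracial_state_def tracial_state_def fun_eq_iff)
qed

text \<open>By density one factor may be taken homogeneous. Its coefficient is moved across by the
  trace property of \<open>\<phi>\<close>, its unitary by \<open>E_conj\<close> and
  invariance.\<close>

lemma tracial_state_extension:
  assumes \<phi>: "invariant_tracial_state G \<alpha> \<phi>"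
  shows "tracial_state (\<phi> \<circ> E)"
proof -
  have st: "state \<phi>" and tr: "\<And>a b. \<phi> (a * b) = \<phi> (b * a)"
    and inv: "\<And>g a. g \<in> carrier G \<Longrightarrow> \<phi> (\<alpha> g a) = \<phi> a"
    using \<phi> by (auto simp: invariant_tracial_state_def tracial_state_def fun_eq_iff)
  have lin: "clinear \<phi>" using st by (simp add: state_def)
  note [simp] = clinear_simps[OF lin]
  have "\<forall>y. \<phi> (E (x * y)) = \<phi> (E (y * x))" for x
  proof (rule closed_supportedI[where P = "\<lambda>x. \<forall>y. \<phi> (E (x * y)) = \<phi> (E (y * x))"])
    show "closed {x. \<forall>y. \<phi> (E (x * y)) = \<phi> (E (y * x))}"
      by (intro closed_Collect_all closed_Collect_eq continuous_intros
          bounded_linear.continuous_on[OF bounded_linear_E]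
          bounded_linear.continuous_on[OF state_bounded_linear[OF st]])
  next
    fix M x assume x: "supported M x"
    show "\<forall>y. \<phi> (E (x * y)) = \<phi> (E (y * x))"
    proof
      fix y
      have hom: "\<phi> (E (component g x * y)) = \<phi> (E (y * component g x))" if "g \<in> M" for g
      proof -
        have g: "g \<in> carrier G" using that supportedD(2)[OF x] by blast
        obtain a where a: "component g x = \<iota> a * l g"
          using component_homogeneous unfolding homogeneous_def by blast
        have "\<phi> (E (component g x * y)) = \<phi> (a * E (l g * y))" by (simp add: a mult.assoc E_left)
        also have "\<dots> = \<phi> (E (l g * y) * a)" by (rule tr)
        \<comment> \<open>Inserting the unitary and its adjoint turns the argument of
          \<open>E\<close> into a conjugate of \<open>y * component g x\<close>.\<close>
        also have "E (l g * y) * a = E (l g * (y * component g x) * (l g)\<^sup>\<star>)"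
          using g by (simp add: a mult.assoc flip: E_right)
        also have "\<phi> \<dots> = \<phi> (E (y * component g x))" using g by (simp add: E_conj inv)
        finally show ?thesis .
      qed
      have "\<phi> (E (x * y)) = (\<Sum>g\<in>M. \<phi> (E (component g x * y)))"
        by (subst supportedD(3)[OF x, symmetric]) (simp add: sum_distrib_right)
      also have "\<dots> = (\<Sum>g\<in>M. \<phi> (E (y * component g x)))" using hom by (rule sum.cong[OF refl])
      also have "\<dots> = \<phi> (E (y * (\<Sum>g\<in>M. component g x)))" by (simp add: sum_distrib_left)
      finally show "\<phi> (E (x * y)) = \<phi> (E (y * x))" by (simp add: supportedD(3)[OF x])
    qed
  qed
  moreover have "state (\<phi> \<circ> E)" using st E_positive by (simp add: state_def clinear_def)
  ultimately show ?thesis by (simp add: tracial_state_def)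
qed

text \<open>Existence is the extension of \<open>\<phi>\<close> by \<open>E\<close>. For uniqueness,
  the restriction of a trace to \<open>A\<close> must be \<open>\<phi>\<close>, and the trace is
  recovered from it through \<open>E\<close>.\<close>

lemma unique_tracial_state:
  assumes P: "class_P G" and ex1: "\<exists>!\<phi>. invariant_tracial_state G \<alpha> \<phi>"
  shows "\<exists>!\<tau> :: 'b \<Rightarrow> complex. tracial_state \<tau>"
proof -
  obtain \<phi> where \<phi>: "invariant_tracial_state G \<alpha> \<phi>" using ex1 by blast
  show ?thesis
  proof
    show "tracial_state (\<phi> \<circ> E)" using \<phi> by (rule tracial_state_extension)
    fix \<tau> :: "'b \<Rightarrow> complex" assume \<tau>: "tracial_state \<tau>"
    have "\<tau> \<circ> \<iota> = \<phi>" using invariant_tracial_state_restriction[OF \<tau>] \<phi> ex1 by blast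
    thus "\<tau> = \<phi> \<circ> E" using tracial_state_factors[OF P \<tau>] by (auto simp: fun_eq_iff)
  qed
qed

section \<open>Ideals and simplicity\<close>

text \<open>The elements \<open>1 - (1 - w) ^ n\<close> lie in \<open>J\<close> and converge to 1;
  closedness of \<open>J\<close> replaces inverting \<open>w\<close>.\<close>

lemma ideal_near_one:
  fixes J :: "'c::unital_cstar_algebra set"
  assumes J: "cstar_ideal J" and w: "w \<in> J" and near: "norm (1 - w) < 1"
  shows "J = UNIV"
proof -
  have add: "x + y \<in> J" if "x \<in> J" "y \<in> J" for x y using J that unfolding cstar_ideal_def by blast
  have left: "a * x \<in> J" if "x \<in> J" for a x using J that unfolding cstar_ideal_def by blast
  have pow: "1 - (1 - w) ^ n \<in> J" for n
  proof (induction n)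
    case 0 show ?case using J by (simp add: cstar_ideal_def)
  next
    case (Suc n)
    have "1 - (1 - w) ^ Suc n = (1 - (1 - w) ^ n) + (1 - w) ^ n * w"
      by (simp only: power_Suc2 right_diff_distrib mult_1_right) simp
    thus ?case using add[OF Suc left[OF w, of "(1 - w) ^ n"]] by (simp only:)
  qed
  have "(\<lambda>n. 1 - (1 - w) ^ n) \<longlonglongrightarrow> 1 - 0"
    using near by (intro tendsto_intros LIMSEQ_power_zero)
  hence "1 \<in> J"
    using J pow closed_sequentially[of J "\<lambda>n. 1 - (1 - w) ^ n" 1] unfolding cstar_ideal_def by simp
  hence "a \<in> J" for a using left[of 1 a] by simp
  thus ?thesis by blast
qed

lemma cstar_ideal_zero: "cstar_ideal {0::'c::unital_cstar_algebra}"
  by (simp add: cstar_ideal_def)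

lemma \<alpha>_one: "\<alpha> \<one> a = a"
  using E_\<iota>[of "\<alpha> \<one> a"] covariance[of \<one> a] by simp

text \<open>\<open>E\<close> commutes with multiplication by \<open>A\<close> and turns conjugation
  by \<open>l g\<close> into \<open>\<alpha> g\<close>, so the image of \<open>J\<close> inherits
  the ideal properties and the invariance.\<close>

lemma invariant_ideal_closure_expectation:
  assumes J: "cstar_ideal J"
  shows "invariant_ideal G \<alpha> (closure (E ` J))"
proof -
  let ?K = "closure (E ` J)"
  have add: "x + y \<in> J" if "x \<in> J" "y \<in> J" for x y using J that unfolding cstar_ideal_def by blast
  have mult: "a * x \<in> J" "x * a \<in> J" if "x \<in> J" for a x using J that unfolding cstar_ideal_def by blast+
  have scale: "c *\<^sub>C x \<in> J" if "x \<in> J" for c x using J that unfolding cstar_ideal_def by blast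
  have E_scale: "c *\<^sub>C E x \<in> E ` J" if "x \<in> J" for c x
    using scale[OF that] by (rule rev_image_eqI) simp
  have E_mult_left: "a * E x \<in> E ` J" if "x \<in> J" for a x
    using mult(1)[OF that, of "\<iota> a"] by (rule rev_image_eqI) (simp add: E_left)
  have E_mult_right: "E x * a \<in> E ` J" if "x \<in> J" for a x
    using mult(2)[OF that, of "\<iota> a"] by (rule rev_image_eqI) (simp add: E_right)
  have E_plus: "E x + E y \<in> E ` J" if "x \<in> J" "y \<in> J" for x y
    using add[OF that] by (rule rev_image_eqI) simp
  have mapK: "F b \<in> ?K" if F: "bounded_linear F" and FJ: "\<And>x. x \<in> J \<Longrightarrow> F (E x) \<in> E ` J" and b: "b \<in> ?K"
    for F :: "'a \<Rightarrow> 'a" and b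
  proof -
    have "F ` ?K \<subseteq> closure (F ` E ` J)"
      by (intro image_closure_subset[OF bounded_linear.continuous_on[OF F continuous_on_id], simplified]
          closure_subset closed_closure)
    also have "\<dots> \<subseteq> ?K" using FJ by (intro closure_mono) auto
    finally show ?thesis using b by blast
  qed
  have ideal: "cstar_ideal ?K"
    unfolding cstar_ideal_def
  proof (intro conjI ballI allI)
    have "0 \<in> J" using J by (simp add: cstar_ideal_def)
    hence "0 \<in> E ` J" by (rule rev_image_eqI) simp
    thus "0 \<in> ?K" using closure_subset by blast
    fix b assume b: "b \<in> ?K"
    show "c *\<^sub>C b \<in> ?K" for c
      using bounded_linear_scaleC E_scale b by (rule mapK)
    show "a * b \<in> ?K" for a
      using bounded_linear_mult_right E_mult_left b by (rule mapK)
    show "b * a \<in> ?K" for a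
      using bounded_linear_mult_left E_mult_right b by (rule mapK)
    fix d assume d: "d \<in> ?K"
    obtain f g where f: "\<And>n::nat. f n \<in> E ` J" "f \<longlonglongrightarrow> b" and g: "\<And>n::nat. g n \<in> E ` J" "g \<longlonglongrightarrow> d"
      using b d unfolding closure_sequential by blast
    show "b + d \<in> ?K"
      unfolding closure_sequential
    proof (intro exI conjI allI)
      show "f n + g n \<in> E ` J" for n
        using f(1)[of n] g(1)[of n] E_plus by auto
      show "(\<lambda>n. f n + g n) \<longlonglongrightarrow> b + d" by (intro tendsto_intros f g)
    qed
  qed simp
  have sub: "\<alpha> g b \<in> ?K" if g: "g \<in> carrier G" and b: "b \<in> ?K" for g b
  proof (rule mapK[OF bounded_linear_\<alpha>[OF g] _ b])
    show "\<alpha> g (E x) \<in> E ` J" if "x \<in> J" for x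
      using mult(2)[OF mult(1)[OF that, of "l g"], of "(l g)\<^sup>\<star>"] by (rule rev_image_eqI) (simp add: E_conj[OF g])
  qed
  have sup: "b \<in> \<alpha> g ` ?K" if g: "g \<in> carrier G" and b: "b \<in> ?K" for g b
  proof -
    let ?s = "\<sigma> g (inv g)"
    have s: "?s * ?s\<^sup>\<star> = 1" using unitary_cocycle[of g "inv g"] g by (simp add: unitary_def)
    \<comment> \<open>In the twisted setting \<open>\<alpha> (inv g)\<close> inverts
      \<open>\<alpha> g\<close> only up to conjugation by the cocycle unitary, which
      \<open>c\<close> undoes in advance.\<close>
    define c where "c = ?s\<^sup>\<star> * b * ?s"
    have "c \<in> ?K" unfolding c_def using ideal b unfolding cstar_ideal_def by blast
    have "\<alpha> g (\<alpha> (inv g) c) = ?s * \<alpha> \<one> c * ?s\<^sup>\<star>"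
      using fun_cong[OF twisted_action[of g "inv g"], of c] g by (simp add: Ad_def)
    also have "\<dots> = (?s * ?s\<^sup>\<star>) * b * (?s * ?s\<^sup>\<star>)" by (simp only: \<alpha>_one c_def mult.assoc)
    finally have "\<alpha> g (\<alpha> (inv g) c) = b" by (simp add: s)
    moreover have "\<alpha> (inv g) c \<in> ?K" using g \<open>c \<in> ?K\<close> by (intro sub) simp_all
    ultimately show ?thesis by blast
  qed
  show ?thesis unfolding invariant_ideal_def using ideal sub sup by blast
qed

lemma simple_of_minimal:
  assumes P: "class_P G" and minimal: "minimal_system G \<alpha>"
  shows "cstar_simple TYPE('b)"
proof -
  have "J = {0}" if J: "cstar_ideal J" and proper: "J \<noteq> UNIV" for J :: "'b set"
  proof (rule ccontr)
    assume "J \<noteq> {0}"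
    moreover have "0 \<in> J" using J by (simp add: cstar_ideal_def)
    ultimately obtain x where x: "x \<in> J" "x \<noteq> 0" by blast
    have "x\<^sup>\<star> * x \<in> J" using J x unfolding cstar_ideal_def by blast
    moreover have "E (x\<^sup>\<star> * x) \<noteq> 0"
      using faithful x(2) adj_mult_eq_0 unfolding faithful_def by blast
    ultimately have "closure (E ` J) \<noteq> {0}" using closure_subset[of "E ` J"] by blast
    hence "closure (E ` J) = UNIV"
      using minimal invariant_ideal_closure_expectation[OF J] unfolding minimal_system_def by blast
    obtain C where C: "0 < C" "\<And>a. norm (\<iota> a) \<le> norm a * C"
      using bounded_linear.pos_bounded[OF bounded_linear_\<iota>] by blast
    have "1 \<in> closure (E ` J)" using \<open>closure (E ` J) = UNIV\<close> by simp
    \<comment> \<open>The tolerance is chosen so that \<open>\<iota> (E y - 1)\<close> has norm at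
      most 1/2.\<close>
    then obtain y where y: "y \<in> J" "norm (E y - 1) < 1 / (2 * C)"
      using C(1) unfolding closure_approachable dist_norm by (auto dest: spec[of _ "1 / (2 * C)"])
    define d where "d = y - \<iota> (E y)"
    have "E d = 0" by (simp add: d_def)
    then obtain M \<Phi> where M: "iterated_average M \<Phi>" "norm (\<Phi> d) < 1 / 2"
      using iterated_average_small[OF P, of d "1 / 2"] by auto
    \<comment> \<open>Averaging fixes 1, so \<open>1 - \<Phi> y\<close> is the sum of two terms, one
      of norm at most 1/2 and one strictly smaller than 1/2.\<close>
    have "1 - y = - \<iota> (E y - 1) - d" by (simp add: d_def)
    hence "1 - \<Phi> y = - \<Phi> (\<iota> (E y - 1)) - \<Phi> d"
      by (metis iterated_average_one[OF M(1)] clinear_diff[OF clinear_iterated_average[OF M(1)]]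
          clinear_minus[OF clinear_iterated_average[OF M(1)]])
    hence "norm (1 - \<Phi> y) \<le> norm (\<Phi> (\<iota> (E y - 1))) + norm (\<Phi> d)"
      by (metis norm_minus_cancel norm_triangle_ineq4)
    also have "norm (\<Phi> (\<iota> (E y - 1))) \<le> norm (\<iota> (E y - 1))" by (rule norm_iterated_average_le[OF M(1)])
    also have "norm (\<iota> (E y - 1)) \<le> norm (E y - 1) * C" by (rule C(2))
    also have "norm (E y - 1) * C \<le> 1 / 2" using y(2) C(1) by (simp add: field_simps)
    finally have "norm (1 - \<Phi> y) < 1" using M(2) by simp
    thus False using ideal_near_one[OF J iterated_average_ideal[OF M(1) J y(1)]] proper by blast
  qed
  moreover have "({0} :: 'b set) \<noteq> UNIV" by (metis UNIV_I singletonD zero_neq_one)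
  ultimately show ?thesis unfolding cstar_simple_def by (auto simp: cstar_ideal_zero)
qed

end

theorem corollary3p10:
  fixes G :: "('g, 'm) monoid_scheme"
    and \<alpha> :: "'g \<Rightarrow> 'a::unital_cstar_algebra \<Rightarrow> 'a"
    and \<sigma> :: "'g \<Rightarrow> 'g \<Rightarrow> 'a"
    and \<iota> :: "'a \<Rightarrow> 'b::unital_cstar_algebra"
    and l :: "'g \<Rightarrow> 'b"
  assumes "twisted_cstar_system G \<alpha> \<sigma>"
    and "class_P G"
    and "is_reduced_crossed_product G \<alpha> \<sigma> \<iota> l"
  shows "((\<exists>!\<phi>. invariant_tracial_state G \<alpha> \<phi>) \<longrightarrow> (\<exists>!\<tau> :: 'b \<Rightarrow> complex. tracial_state \<tau>)) \<and>
         (minimal_system G \<alpha> \<longrightarrow> cstar_simple TYPE('b))"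
proof -
  obtain E where "conditional_expectation \<iota> E" "faithful E"
      "\<And>g. g \<in> carrier G \<Longrightarrow> g \<noteq> \<one>\<^bsub>G\<^esub> \<Longrightarrow> E (l g) = 0"
    using assms(3) unfolding is_reduced_crossed_product_def by blast
  hence "reduced_crossed_product G \<alpha> \<sigma> \<iota> l E"
    using assms(1,3)
    by (simp add: reduced_crossed_product_def reduced_crossed_product_axioms_def
        is_reduced_crossed_product_def)
  then interpret reduced_crossed_product G \<alpha> \<sigma> \<iota> l E .
  show ?thesis using unique_tracial_state[OF assms(2)] simple_of_minimal[OF assms(2)] by blast
qed

end
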